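(* Let $(\mathbb{X},\mathbb{U},\mathcal{T},c)$ be a Markov decision process with $\mathbb{X}\subset\mathbb{R}^n$ Borel, $\mathbb{U}$ finite, $c:\mathbb{X}\times\mathbb{U}\to\mathbb{R}$ continuous and bounded, and discount factor $\beta\in(0,1)$. Assume there are constants $\alpha_c,\alpha_T>0$ such that for all $x,x'\in\mathbb{X}$, $u\in\mathbb{U}$: $|c(x,u)-c(x',u)|\le\alpha_c\|x-x'\|_1$ and $\|\mathcal{T}(\cdot|x,u)-\mathcal{T}(\cdot|x',u)\|_{TV}\le\alpha_T\|x-x'\|_1$. Let $\{B_i\}_{i=1}^M$ be a collection of quantization bins (a measurable partition of $\mathbb{X}$) with quantizer $q$, and suppose quantized Q-learning is run under an exploration policy $\gamma^*$ such that: 1. the step sizes are $\alpha_t(y,u)=0$ if $(Y_t,U_t)\ne(y,u)$ and $\alpha_t(y,u)=\frac{1}{1+\sum_{k=0}^t\mathbf{1}\{Y_k=y,U_k=u\}}$ otherwise, where $Y_t=q(X_t)$; 2. under $\gamma^*$ the state process $\{X_t\}_{t\ge0}$ is uniquely ergodic, with unique invariant probability measure $\pi_{\gamma^*}$; 3. during exploration each pair $(y,u)$ is visited infinitely often. Let $Q^*$ be the limit Q-function (defined in the context). Then for any initial state $x_0\in\mathbb{X}$, $$\left|J^*_\beta(x_0)-\min_{v\in\mathbb{U}}Q^*(x_0,v)\right|\le\left(\alpha_c+\frac{\beta\alpha_T\|c\|_\infty}{1-\beta}\right)\sup_{\gamma_s\in\Gamma_s}\frac{1}{1-\beta}\sum_{i=1}^M\int_{B_i}\int_{B_i}\|x-x'\|_1\,\mu_\beta^{\gamma_s}(dx)\,\hat\pi_{y_i}(dx'),$$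 where $\Gamma_s$ is the set of stationary policies, $\mu_\beta^{\gamma_s}$ is the normalized discounted occupation measure under $\gamma_s$ started from $x_0$, and $\hat\pi_{y_i}$ is the normalized restriction of $\pi_{\gamma^*}$ to $B_i$.
   Context: MDP: $\mathcal{T}(\cdot|x,u)$ is a stochastic kernel from $\mathbb{X}\times\mathbb{U}$ to $\mathbb{X}$. An admissible policy $\gamma=\{\gamma_t\}$ chooses $U_t=\gamma_t(X_0,\dots,X_t,U_0,\dots,U_{t-1})$ measurably; a stationary policy is given by a measurable $f:\mathbb{X}\to\mathbb{U}$ with $U_t=f(X_t)$ for all $t$. $J_\beta^*(x_0)=\inf_{\gamma}\mathbb{E}^\gamma_{x_0}[\sum_{t\ge0}\beta^tc(X_t,U_t)]$ over admissible $\gamma$. Quantizer: each bin $B_i$ has a representative $y_i\in B_i$; $\mathbb{Y}=\{y_1,\dots,y_M\}$; $q(x)=y_i$ for $x\in B_i$; $B_y$ denotes the bin of $y\in\mathbb{Y}$. It is assumed that $\pi_{\gamma^*}(B_i)>0$ for every $i$, and $\hat\pi_{y_i}(A)=\pi_{\gamma^*}(A)/\pi_{\gamma^*}(B_i)$ for measurable $A\subseteq B_i$. Quantized Q-learning: along the trajectory generated by $\gamma^*$, $Q_{t+1}(y,u)=(1-\alpha_t(y,u))Q_t(y,u)+\alpha_t(y,u)\big(c(X_t,U_t)+\beta\min_{v\in\mathbb{U}}Q_t(q(X_{t+1}),v)\big)$ at $(y,u)=(q(X_t),U_t)$, other entries unchanged. Its almost sure limit $Q^*:\mathbb{Y}\times\mathbb{U}\to\mathbb{R}$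 is the solution of $$Q^*(y,u)=C^*(y,u)+\beta\sum_{y'\in\mathbb{Y}}P^*(y'|y,u)\min_{v\in\mathbb{U}}Q^*(y',v),$$ with $C^*(y,u)=\frac{1}{\pi_{\gamma^*}(B_y)}\int_{B_y}c(x,u)\,\pi_{\gamma^*}(dx)$ and $P^*(y'|y,u)=\frac{1}{\pi_{\gamma^*}(B_y)}\int_{B_y}\mathcal{T}(B_{y'}|x,u)\,\pi_{\gamma^*}(dx)$. For $x\in\mathbb{X}$, $Q^*(x,v):=Q^*(q(x),v)$. Occupation measure: $\mu_\beta^{\gamma_s}(A)=(1-\beta)\sum_{t=0}^\infty\beta^t\,\mathbb{P}^{\gamma_s}_{x_0}(X_t\in A)$ for Borel $A\subseteq\mathbb{X}$. Conventions: $\|\cdot\|_1$ is the $\ell_1$ norm on $\mathbb{R}^n$; $\|\mu-\nu\|_{TV}=\sup_{\|f\|_\infty\le1}|\int f\,d\mu-\int f\,d\nu|$. The right-hand side may be $+\infty$. *)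

theory Defs
  imports "HOL-Probability.Probability"
begin

definition l1_norm :: "real ^ 'n \<Rightarrow> real" where
  "l1_norm x = (\<Sum>i\<in>UNIV. \<bar>x $ i\<bar>)"

text \<open>Total variation in the normalization where the supremum runs over test functions bounded
  by 1, so that two mutually singular probability measures are at distance 2.\<close>

definition tv_dist :: "'a measure \<Rightarrow> 'a measure \<Rightarrow> real" where
  "tv_dist M N = (SUP f\<in>{f \<in> borel_measurable M. \<forall>x\<in>space M. \<bar>f x\<bar> \<le> 1}.
     \<bar>(\<integral>x. f x \<partial>M) - (\<integral>x. f x \<partial>N)\<bar>)"

definition sup_norm_on :: "'x set \<Rightarrow> ('x \<Rightarrow> 'u \<Rightarrow> real) \<Rightarrow> real" where
  "sup_norm_on X c = (SUP (x, u)\<in>X \<times> UNIV. \<bar>c x u\<bar>)"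

subsection \<open>Policies and controlled trajectories\<close>

text \<open>The state space is a Borel subset \<open>X\<close> of a Euclidean space, the control space is a
  finite type with the discrete sigma-algebra. A trajectory is a sequence of state-control pairs
  \<open>(X\<^sub>t, U\<^sub>t)\<close>.\<close>

abbreviation state_space :: "'x::topological_space set \<Rightarrow> 'x measure" where
  "state_space X \<equiv> restrict_space borel X"

abbreviation control_space :: "'u measure" where
  "control_space \<equiv> count_space UNIV"

abbreviation step_space :: "'x::topological_space set \<Rightarrow> ('x \<times> 'u) measure" where
  "step_space X \<equiv> state_space X \<Otimes>\<^sub>M control_space"

text \<open>The information available at time \<open>t\<close>: the states \<open>X\<^sub>0, \<dots>, X\<^sub>t\<close> and the
  controls \<open>U\<^sub>0, \<dots>, U\<^sub>t\<^sub>-\<^sub>1\<close>.\<close>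

type_synonym ('x, 'u) information = "(nat \<Rightarrow> 'x) \<times> (nat \<Rightarrow> 'u)"

definition information_space ::
    "'x::topological_space set \<Rightarrow> nat \<Rightarrow> ('x, 'u) information measure" where
  "information_space X t =
     PiM {..t} (\<lambda>_. state_space X) \<Otimes>\<^sub>M PiM {..<t} (\<lambda>_. control_space)"

definition admissible_policies ::
    "'x::topological_space set \<Rightarrow> (nat \<Rightarrow> ('x, 'u) information \<Rightarrow> 'u) set" where
  "admissible_policies X = {g. \<forall>t. g t \<in> information_space X t \<rightarrow>\<^sub>M control_space}"

definition randomized_policies ::
    "'x::topological_space set \<Rightarrow> (nat \<Rightarrow> ('x, 'u) information \<Rightarrow> 'u measure) set" where
  "randomized_policies X =
     {\<gamma>. \<forall>t. \<gamma> t \<in> information_space X t \<rightarrow>\<^sub>M prob_algebra control_space}"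

definition deterministic ::
    "(nat \<Rightarrow> ('x, 'u) information \<Rightarrow> 'u) \<Rightarrow> nat \<Rightarrow> ('x, 'u) information \<Rightarrow> 'u measure" where
  "deterministic g = (\<lambda>t h. return control_space (g t h))"

definition stationary :: "('x \<Rightarrow> 'u) \<Rightarrow> nat \<Rightarrow> ('x, 'u) information \<Rightarrow> 'u" where
  "stationary f = (\<lambda>t (xs, us). f (xs t))"

definition information :: "nat \<Rightarrow> (nat \<Rightarrow> 'x \<times> 'u) \<Rightarrow> 'x \<Rightarrow> ('x, 'u) information" where
  "information t \<omega> x =
     ((\<lambda>i\<in>{..t}. if i < t then fst (\<omega> i) else x), (\<lambda>i\<in>{..<t}. snd (\<omega> i)))"

text \<open>Conditional law of \<open>(X\<^sub>t, U\<^sub>t)\<close> given \<open>\<omega> 0, \<dots>, \<omega> (t - 1)\<close>, where \<open>\<nu>\<close> is the law of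
  \<open>X\<^sub>0\<close>.\<close>

definition step_kernel ::
    "'x::topological_space set \<Rightarrow> ('x \<Rightarrow> 'u \<Rightarrow> 'x measure) \<Rightarrow> 'x measure \<Rightarrow>
     (nat \<Rightarrow> ('x, 'u) information \<Rightarrow> 'u measure) \<Rightarrow>
     nat \<Rightarrow> (nat \<Rightarrow> 'x \<times> 'u) \<Rightarrow> ('x \<times> 'u) measure" where
  "step_kernel X T \<nu> \<gamma> t \<omega> =
     do { x \<leftarrow> (if t = 0 then \<nu> else T (fst (\<omega> (t - 1))) (snd (\<omega> (t - 1))));
          u \<leftarrow> \<gamma> t (information t \<omega> x);
          return (step_space X) (x, u) }"

text \<open>The law of the whole trajectory is the Ionescu-Tulcea measure generated by these kernels;
  \<open>projective_family.lim UNIV (Ionescu_Tulcea.CI K M) M\<close> is what the library calls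
  \<open>PF.lim\<close> inside the locale \<^locale>\<open>Ionescu_Tulcea\<close>.\<close>

definition trajectory_law ::
    "'x::topological_space set \<Rightarrow> ('x \<Rightarrow> 'u \<Rightarrow> 'x measure) \<Rightarrow> 'x measure \<Rightarrow>
     (nat \<Rightarrow> ('x, 'u) information \<Rightarrow> 'u measure) \<Rightarrow> (nat \<Rightarrow> 'x \<times> 'u) measure" where
  "trajectory_law X T \<nu> \<gamma> =
     projective_family.lim UNIV
       (Ionescu_Tulcea.CI (step_kernel X T \<nu> \<gamma>) (\<lambda>_. step_space X)) (\<lambda>_. step_space X)"

lemma Ionescu_Tulcea_step_kernel:
  fixes T :: "'x::topological_space \<Rightarrow> 'u::finite \<Rightarrow> 'x measure"
  assumes T: "(\<lambda>(x, u). T x u) \<in> step_space X \<rightarrow>\<^sub>M prob_algebra (state_space X)"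
    and nu: "\<nu> \<in> space (prob_algebra (state_space X))"
    and gamma: "\<gamma> \<in> randomized_policies X"
  shows "Ionescu_Tulcea (step_kernel X T \<nu> \<gamma>) (\<lambda>_. step_space X)"
proof -
  let ?S = "state_space X" and ?C = "control_space :: 'u measure"
  have meas: "step_kernel X T \<nu> \<gamma> t
      \<in> PiM {0..<t} (\<lambda>_. step_space X) \<rightarrow>\<^sub>M prob_algebra (step_space X)" for t
  proof -
    let ?H = "PiM {0..<t} (\<lambda>_. step_space X :: ('x \<times> 'u) measure)"
    have comp: "(\<lambda>\<omega>. \<omega> i) \<in> ?H \<rightarrow>\<^sub>M step_space X" if "i < t" for i
      using that by (intro measurable_component_singleton) auto
    have state: "(\<lambda>\<omega>. if t = 0 then \<nu> else T (fst (\<omega> (t - 1))) (snd (\<omega> (t - 1))))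
        \<in> ?H \<rightarrow>\<^sub>M prob_algebra ?S"
    proof (cases "t = 0")
      case True
      then show ?thesis using nu by simp
    next
      case False
      then have "(\<lambda>\<omega>. \<omega> (t - 1)) \<in> ?H \<rightarrow>\<^sub>M step_space X"
        by (intro comp) auto
      from measurable_compose[OF this T] False show ?thesis
        by (simp add: case_prod_beta)
    qed
    have info: "(\<lambda>(\<omega>, x). information t \<omega> x) \<in> ?H \<Otimes>\<^sub>M ?S \<rightarrow>\<^sub>M information_space X t"
      unfolding information_def information_space_def case_prod_beta
    proof (intro measurable_Pair measurable_restrict)
      fix i assume "i \<in> {..t}"
      show "(\<lambda>p. if i < t then fst (fst p i) else snd p) \<in> ?H \<Otimes>\<^sub>M ?S \<rightarrow>\<^sub>M ?S"
        using measurable_compose[OF measurable_compose[OF measurable_fst comp] measurable_fst]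
        by (cases "i < t") simp_all
    next
      fix i assume "i \<in> {..<t}"
      then show "(\<lambda>p. snd (fst p i)) \<in> ?H \<Otimes>\<^sub>M ?S \<rightarrow>\<^sub>M ?C"
        using measurable_compose[OF measurable_compose[OF measurable_fst comp] measurable_snd]
        by simp
    qed
    have "\<gamma> t \<in> information_space X t \<rightarrow>\<^sub>M prob_algebra ?C"
      using gamma by (simp add: randomized_policies_def)
    from measurable_compose[OF info this]
    have control: "(\<lambda>p. \<gamma> t (information t (fst p) (snd p)))
        \<in> ?H \<Otimes>\<^sub>M ?S \<rightarrow>\<^sub>M prob_algebra ?C"
      by (simp add: case_prod_beta)
    have pair: "(\<lambda>(p, u). return (step_space X) (snd p, u))
        \<in> (?H \<Otimes>\<^sub>M ?S) \<Otimes>\<^sub>M ?C \<rightarrow>\<^sub>M prob_algebra (step_space X)"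
      unfolding case_prod_beta
      by (rule measurable_compose[OF _ measurable_return_prob_space]) measurable
    have "(\<lambda>p. \<gamma> t (information t (fst p) (snd p)) \<bind>
          (\<lambda>u. return (step_space X) (snd p, u)))
        \<in> ?H \<Otimes>\<^sub>M ?S \<rightarrow>\<^sub>M prob_algebra (step_space X)"
      by (rule measurable_bind_prob_space2[OF control pair])
    then show ?thesis
      unfolding step_kernel_def
      by (intro measurable_bind_prob_space2[OF state]) (simp add: case_prod_beta)
  qed
  show ?thesis
  proof (rule Ionescu_Tulcea.intro)
    show "step_kernel X T \<nu> \<gamma> i
        \<in> PiM {0..<i} (\<lambda>_. step_space X) \<rightarrow>\<^sub>M subprob_algebra (step_space X)" for i
      using meas by (rule measurable_prob_algebraD)
    show "prob_space (step_kernel X T \<nu> \<gamma> i x)"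
      if "x \<in> space (PiM {0..<i} (\<lambda>_. step_space X))" for i x
      using measurable_space[OF meas that] by (simp add: space_prob_algebra)
  qed
qed

definition discounted_cost ::
    "'x::topological_space set \<Rightarrow> ('x \<Rightarrow> 'u \<Rightarrow> 'x measure) \<Rightarrow> ('x \<Rightarrow> 'u \<Rightarrow> real) \<Rightarrow> real \<Rightarrow>
     (nat \<Rightarrow> ('x, 'u) information \<Rightarrow> 'u measure) \<Rightarrow> 'x \<Rightarrow> real" where
  "discounted_cost X T c \<beta> \<gamma> x0 =
     (\<integral>\<omega>. (\<Sum>t. \<beta> ^ t * c (fst (\<omega> t)) (snd (\<omega> t)))
        \<partial>trajectory_law X T (return (state_space X) x0) \<gamma>)"

definition optimal_cost ::
    "'x::topological_space set \<Rightarrow> ('x \<Rightarrow> 'u \<Rightarrow> 'x measure) \<Rightarrow> ('x \<Rightarrow> 'u \<Rightarrow> real) \<Rightarrow> real \<Rightarrow>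
     'x \<Rightarrow> real" where
  "optimal_cost X T c \<beta> x0 =
     (INF g\<in>admissible_policies X. discounted_cost X T c \<beta> (deterministic g) x0)"

definition occupation_measure ::
    "'x::topological_space set \<Rightarrow> ('x \<Rightarrow> 'u \<Rightarrow> 'x measure) \<Rightarrow> real \<Rightarrow>
     (nat \<Rightarrow> ('x, 'u) information \<Rightarrow> 'u measure) \<Rightarrow> 'x \<Rightarrow> 'x measure" where
  "occupation_measure X T \<beta> \<gamma> x0 =
     (let P = trajectory_law X T (return (state_space X) x0) \<gamma> in
      measure_of X (sets (state_space X))
        (\<lambda>A. ennreal (1 - \<beta>) *
              (\<Sum>t. ennreal (\<beta> ^ t) * emeasure P {\<omega> \<in> space P. fst (\<omega> t) \<in> A})))"

text \<open>Invariance of \<open>\<pi>\<close> for the state process under a possibly history dependent policy: a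
  process started from \<open>X\<^sub>0 \<sim> \<pi>\<close> has \<open>X\<^sub>t \<sim> \<pi>\<close> for all \<open>t\<close>. When \<open>\<gamma>\<close> is stationary
  (possibly randomized), this is invariance under the transition kernel of the Markov chain
  \<open>X\<^sub>t\<close>.\<close>

definition invariant_state_law ::
    "'x::topological_space set \<Rightarrow> ('x \<Rightarrow> 'u \<Rightarrow> 'x measure) \<Rightarrow>
     (nat \<Rightarrow> ('x, 'u) information \<Rightarrow> 'u measure) \<Rightarrow> 'x measure \<Rightarrow> bool" where
  "invariant_state_law X T \<gamma> \<pi> \<longleftrightarrow>
     \<pi> \<in> space (prob_algebra (state_space X)) \<and>
     (\<forall>t. distr (trajectory_law X T \<pi> \<gamma>) (state_space X) (\<lambda>\<omega>. fst (\<omega> t)) = \<pi>)"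

definition uniquely_ergodic ::
    "'x::topological_space set \<Rightarrow> ('x \<Rightarrow> 'u \<Rightarrow> 'x measure) \<Rightarrow>
     (nat \<Rightarrow> ('x, 'u) information \<Rightarrow> 'u measure) \<Rightarrow> 'x measure \<Rightarrow> bool" where
  "uniquely_ergodic X T \<gamma> \<pi> \<longleftrightarrow>
     invariant_state_law X T \<gamma> \<pi> \<and> (\<forall>\<pi>'. invariant_state_law X T \<gamma> \<pi>' \<longrightarrow> \<pi>' = \<pi>)"

subsection \<open>Quantization and Q-learning\<close>

definition quantization ::
    "'x::topological_space set \<Rightarrow> nat \<Rightarrow> (nat \<Rightarrow> 'x set) \<Rightarrow> (nat \<Rightarrow> 'x) \<Rightarrow> ('x \<Rightarrow> 'x) \<Rightarrow> bool" where
  "quantization X M B y q \<longleftrightarrow>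
     (\<forall>i\<in>{1..M}. B i \<in> sets (state_space X)) \<and>
     disjoint_family_on B {1..M} \<and> (\<Union>i\<in>{1..M}. B i) = X \<and>
     (\<forall>i\<in>{1..M}. y i \<in> B i \<and> (\<forall>x\<in>B i. q x = y i))"

definition bin_of :: "'x set \<Rightarrow> ('x \<Rightarrow> 'x) \<Rightarrow> 'x \<Rightarrow> 'x set" where
  "bin_of X q z = {x \<in> X. q x = z}"

text \<open>\<open>a\<close> and \<open>Q\<close> are the step sizes and the iterates along one trajectory \<open>\<omega>\<close>.\<close>

definition q_learning_step_sizes ::
    "('x \<Rightarrow> 'x) \<Rightarrow> 'x set \<Rightarrow> (nat \<Rightarrow> 'x \<times> 'u) \<Rightarrow> (nat \<Rightarrow> 'x \<Rightarrow> 'u \<Rightarrow> real) \<Rightarrow> bool" where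
  "q_learning_step_sizes q Y \<omega> a \<longleftrightarrow>
     (\<forall>t. \<forall>z\<in>Y. \<forall>u. a t z u =
        (if (q (fst (\<omega> t)), snd (\<omega> t)) \<noteq> (z, u) then 0
         else 1 / (1 + (\<Sum>k\<le>t. of_bool (q (fst (\<omega> k)) = z \<and> snd (\<omega> k) = u)))))"

definition q_learning_iterates ::
    "('x \<Rightarrow> 'u::finite \<Rightarrow> real) \<Rightarrow> real \<Rightarrow> ('x \<Rightarrow> 'x) \<Rightarrow> 'x set \<Rightarrow> (nat \<Rightarrow> 'x \<times> 'u) \<Rightarrow>
     (nat \<Rightarrow> 'x \<Rightarrow> 'u \<Rightarrow> real) \<Rightarrow> (nat \<Rightarrow> 'x \<Rightarrow> 'u \<Rightarrow> real) \<Rightarrow> bool" where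
  "q_learning_iterates c \<beta> q Y \<omega> a Q \<longleftrightarrow>
     (\<forall>t. \<forall>z\<in>Y. \<forall>u. Q (Suc t) z u =
        (if (z, u) = (q (fst (\<omega> t)), snd (\<omega> t))
         then (1 - a t z u) * Q t z u +
              a t z u * (c (fst (\<omega> t)) (snd (\<omega> t)) + \<beta> * (MIN v. Q t (q (fst (\<omega> (Suc t)))) v))
         else Q t z u))"

definition quantized_cost ::
    "'x set \<Rightarrow> ('x \<Rightarrow> 'u \<Rightarrow> real) \<Rightarrow> ('x \<Rightarrow> 'x) \<Rightarrow> 'x measure \<Rightarrow> 'x \<Rightarrow> 'u \<Rightarrow> real" where
  "quantized_cost X c q \<pi> z u =
     1 / measure \<pi> (bin_of X q z) * (LINT x:bin_of X q z|\<pi>. c x u)"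

definition quantized_kernel ::
    "'x set \<Rightarrow> ('x \<Rightarrow> 'u \<Rightarrow> 'x measure) \<Rightarrow> ('x \<Rightarrow> 'x) \<Rightarrow> 'x measure \<Rightarrow> 'x \<Rightarrow> 'x \<Rightarrow> 'u \<Rightarrow> real" where
  "quantized_kernel X T q \<pi> z' z u =
     1 / measure \<pi> (bin_of X q z) * (LINT x:bin_of X q z|\<pi>. measure (T x u) (bin_of X q z'))"

text \<open>The limit \<open>Q\<^sup>*\<close> of quantized Q-learning is identified by its fixed point equation, which
  for \<open>0 < \<beta> < 1\<close> and bins of positive mass has exactly one solution on \<open>Y \<times> UNIV\<close>.\<close>

definition is_limit_Q ::
    "'x set \<Rightarrow> ('x \<Rightarrow> 'u::finite \<Rightarrow> 'x measure) \<Rightarrow> ('x \<Rightarrow> 'u \<Rightarrow> real) \<Rightarrow> real \<Rightarrow> ('x \<Rightarrow> 'x) \<Rightarrow>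
     'x set \<Rightarrow> 'x measure \<Rightarrow> ('x \<Rightarrow> 'u \<Rightarrow> real) \<Rightarrow> bool" where
  "is_limit_Q X T c \<beta> q Y \<pi> Qstar \<longleftrightarrow>
     (\<forall>z\<in>Y. \<forall>u. Qstar z u = quantized_cost X c q \<pi> z u +
        \<beta> * (\<Sum>z'\<in>Y. quantized_kernel X T q \<pi> z' z u * (MIN v. Qstar z' v)))"

end

(*
  Let J be the function x |-> min_v Q*(q x, v). The fixed point equation says that Q*(y_i, u) is the
  average over B_i, with respect to the normalized restriction of pi, of the one-step value
  A(x, u) = c(x, u) + beta * (integral of J with respect to T(.|x, u)).
  Since |J| <= ||c|| / (1 - beta), the map x |-> A(x, u) is Lipschitz with the constant of the
  theorem, so |A(x, u) - Q*(q x, u)| is at most this constant times the mean distance D(x) of x to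
  its bin.

  For a stationary policy f, telescoping gives
  J_f(x0) - J(x0) = sum_t beta^t E_f[A(X_t, f(X_t)) - J(X_t)].
  If f is greedy for Q*, the summands are at most E_f[|A - Q*|], which bounds J* - J from above; if f
  is an optimal stationary policy (it exists by value iteration), they are at least -E_f[|A - Q*|],
  as J <= Q*. In both cases the discounted sum of E_f[D(X_t)] is an integral against the occupation
  measure of f.
*)

theory Submission
  imports Defs
begin

subsection \<open>Trajectory laws\<close>

text \<open>Two obstacles shape the proof. Bins may be unbounded, so the mean distance to a bin can
  have infinite expectation and the discounted sum on the right may diverge, whereas values of
  policies are signed reals. Telescoping is therefore done with real expectations of bounded
  functions, and every inequality is truncated at 0 into \<open>ennreal\<close> before a distance
  enters; a sign parameter \<open>s\<close> lets one lemma serve both directions. The other obstacle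
  is the infimum over history dependent policies. The telescoping identity holds for every such
  policy and every bounded measurable function in place of J. Applied to the Bellman fixed point, it
  shows that no policy does better than the stationary greedy one, without a reduction of histories
  to states.\<close>

context Ionescu_Tulcea
begin

text \<open>\<open>CI J\<close> is the projection to \<open>J\<close> of a segment measure of length
  \<open>up_to J\<close>. A lower bound on that length suffices, because projecting a longer segment
  measure gives the shorter one.\<close>

lemma CI_initial_segment: "CI {0..<n} = C 0 n (\<lambda>_. undefined)"
proof -
  have "n \<le> up_to {0..<n}"
    using up_to[of "{0..<n}"] by auto
  then show ?thesis
    using distr_C[of n "up_to {0..<n}" "\<lambda>_. undefined" 0] by (simp add: CI_def)
qed

lemma nn_integral_lim_initial_segment:
  assumes "h \<in> borel_measurable (PiM {0..<n} M)"
  shows "(\<integral>\<^sup>+\<omega>. h (restrict \<omega> {0..<n}) \<partial>PF.lim) = (\<integral>\<^sup>+\<omega>. h \<omega> \<partial>C 0 n (\<lambda>_. undefined))"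
proof -
  have [measurable]: "(\<lambda>\<omega>. restrict \<omega> {0..<n}) \<in> PF.lim \<rightarrow>\<^sub>M PiM {0..<n} M"
    unfolding measurable_cong_sets[OF PF.sets_lim refl] by (intro measurable_restrict_subset) simp
  have "(\<integral>\<^sup>+\<omega>. h (restrict \<omega> {0..<n}) \<partial>PF.lim) = (\<integral>\<^sup>+\<omega>. h \<omega> \<partial>CI {0..<n})"
    unfolding distr_lim[OF finite_atLeastLessThan, symmetric] using assms
    by (subst nn_integral_distr) auto
  then show ?thesis by (simp add: CI_initial_segment)
qed

text \<open>Coordinate \<open>n\<close> is the one appended by \<open>eP n\<close>, whose law given
  the past is \<open>P n\<close>. This disintegration is the source of all later one-step identities
  for trajectories.\<close>

lemma nn_integral_lim_component:
  assumes h[measurable]: "h \<in> borel_measurable (M n)"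
  shows "(\<integral>\<^sup>+\<omega>. h (\<omega> n) \<partial>PF.lim) = (\<integral>\<^sup>+\<omega>. (\<integral>\<^sup>+s. h s \<partial>P n (restrict \<omega> {0..<n})) \<partial>PF.lim)"
proof -
  \<comment> \<open>The empty history, from which \<open>C 0\<close> starts, is the only point of
    the empty product.\<close>
  have [simp]: "(\<lambda>_. undefined) \<in> space (PiM {0..<0} M)" by simp
  have [measurable]: "(\<lambda>\<omega>. h (\<omega> n)) \<in> borel_measurable (PiM {0..<Suc n} M)"
    by (rule measurable_compose[OF _ h]) simp
  have "(\<integral>\<^sup>+\<omega>. h (\<omega> n) \<partial>PF.lim) = (\<integral>\<^sup>+\<omega>. h (restrict \<omega> {0..<Suc n} n) \<partial>PF.lim)" by simp
  also have "\<dots> = (\<integral>\<^sup>+\<omega>. h (\<omega> n) \<partial>C 0 (Suc n) (\<lambda>_. undefined))"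
    by (rule nn_integral_lim_initial_segment) simp
  also have "\<dots> = (\<integral>\<^sup>+\<omega>. (\<integral>\<^sup>+\<omega>'. h (\<omega>' n) \<partial>eP n \<omega>) \<partial>C 0 n (\<lambda>_. undefined))"
    unfolding C.simps add_0
    by (subst nn_integral_bind[where B="PiM {0..<Suc n} M"])
       (simp_all add: measurable_cong_sets[OF sets_C refl] measurable_eP)
  also have "\<dots> = (\<integral>\<^sup>+\<omega>. (\<integral>\<^sup>+s. h s \<partial>P n \<omega>) \<partial>C 0 n (\<lambda>_. undefined))"
    by (intro nn_integral_cong) (simp add: space_C nn_integral_eP)
  also have "\<dots> = (\<integral>\<^sup>+\<omega>. (\<integral>\<^sup>+s. h s \<partial>P n (restrict \<omega> {0..<n})) \<partial>PF.lim)"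
    by (rule nn_integral_lim_initial_segment[symmetric]) measurable
  finally show ?thesis .
qed

end

section \<open>Policies, measurable selection and minima over the finite control set\<close>

lemma measurable_information:
  fixes X :: "'x::topological_space set"
  assumes "\<omega> \<in> space (PiM {0..<t} (\<lambda>_. step_space X :: ('x \<times> 'u) measure))"
  shows "information t \<omega> \<in> state_space X \<rightarrow>\<^sub>M information_space X t"
  unfolding information_def information_space_def
proof (intro measurable_Pair measurable_restrict)
  fix i
  show "(\<lambda>x. if i < t then fst (\<omega> i) else x) \<in> state_space X \<rightarrow>\<^sub>M state_space X"
    using assms by (cases "i < t") (auto simp: space_PiM PiE_iff space_pair_measure mem_Times_iff intro!: measurable_const)
qed simp

lemma deterministic_randomized:
  "g \<in> admissible_policies X \<Longrightarrow> deterministic g \<in> randomized_policies X"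
  unfolding admissible_policies_def randomized_policies_def deterministic_def
  by (auto intro: measurable_compose[OF _ measurable_return_prob_space])

lemma stationary_admissible:
  assumes "f \<in> state_space X \<rightarrow>\<^sub>M control_space"
  shows "stationary f \<in> admissible_policies X"
proof -
  have "(\<lambda>p. f (fst p t)) \<in> information_space X t \<rightarrow>\<^sub>M control_space" for t
    unfolding information_space_def
    by (rule measurable_compose[OF _ assms]) simp
  then show ?thesis
    unfolding admissible_policies_def stationary_def case_prod_beta by blast
qed

text \<open>Ties are broken by the least code of a minimizer: a least index over countably many
  measurable conditions is measurable, which an arbitrary choice of minimizers need not be.\<close>

lemma measurable_greedy_selector:
  fixes h :: "'a \<Rightarrow> 'u::finite \<Rightarrow> real"
  assumes [measurable]: "\<And>u. (\<lambda>x. h x u) \<in> borel_measurable N"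
  obtains f where "f \<in> N \<rightarrow>\<^sub>M count_space UNIV" "\<And>x. h x (f x) = (MIN u. h x u)"
proof
  define f where "f x = (from_nat (LEAST n. \<forall>u. h x (from_nat n) \<le> h x u) :: 'u)" for x
  have "(\<lambda>x. LEAST n. \<forall>u. h x (from_nat n) \<le> h x u) \<in> N \<rightarrow>\<^sub>M count_space UNIV"
    by measurable
  then show "f \<in> N \<rightarrow>\<^sub>M count_space UNIV"
    unfolding f_def by (rule measurable_compose) simp
  show "h x (f x) = (MIN u. h x u)" for x
  proof -
    have "(MIN u. h x u) \<in> range (h x)" by (rule Min_in) auto
    then obtain u where u: "(MIN u. h x u) = h x u" by (rule imageE)
    have min_le: "(MIN u. h x u) \<le> h x v" for v by (rule Min_le) auto
    then have "\<forall>v. h x (from_nat (to_nat u)) \<le> h x v"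
      unfolding from_nat_to_nat u[symmetric] by blast
    then have "\<forall>v. h x (f x) \<le> h x v" unfolding f_def by (rule LeastI)
    then show ?thesis by (intro antisym Min.boundedI) auto
  qed
qed

text \<open>A minimizer of \<open>b\<close> is a competitor in the minimum of \<open>a\<close>, and
  conversely. This is what makes the Bellman operator a contraction.\<close>

lemma abs_MIN_diff_le:
  fixes a b :: "'u::finite \<Rightarrow> real"
  assumes "\<And>u. \<bar>a u - b u\<bar> \<le> e"
  shows "\<bar>(MIN u. a u) - (MIN u. b u)\<bar> \<le> e"
proof -
  have "(MIN u. a u) \<le> (MIN u. b u) + e" if "\<And>u. \<bar>a u - b u\<bar> \<le> e" for a b :: "'u \<Rightarrow> real"
  proof -
    have "(MIN u. b u) \<in> range b" by (rule Min_in) auto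
    then obtain u where u: "(MIN u. b u) = b u" by (rule imageE)
    have "(MIN u. a u) \<le> a u" by (rule Min_le) auto
    with that[of u] u show ?thesis by linarith
  qed
  from this[of a b] this[of b a] assms show ?thesis
    by (simp add: abs_le_iff abs_minus_commute algebra_simps)
qed

lemma abs_MIN_le:
  fixes a :: "'u::finite \<Rightarrow> real"
  assumes "\<And>u. \<bar>a u\<bar> \<le> e"
  shows "\<bar>MIN u. a u\<bar> \<le> e"
  using abs_MIN_diff_le[of a "\<lambda>_. 0" e] assms by simp

lemma tendsto_MIN:
  fixes a :: "nat \<Rightarrow> 'u::finite \<Rightarrow> real"
  assumes "\<And>u. (\<lambda>n. a n u) \<longlonglongrightarrow> b u"
  shows "(\<lambda>n. MIN u. a n u) \<longlonglongrightarrow> (MIN u. b u)"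
proof (rule LIM_zero_cancel, rule Lim_null_comparison)
  \<comment> \<open>The sum over all controls bounds every single difference, hence serves as the
    uniform error \<open>e\<close>.\<close>
  have "\<bar>a n u - b u\<bar> \<le> (\<Sum>u\<in>UNIV. \<bar>a n u - b u\<bar>)" for n u
    by (rule member_le_sum) auto
  then have "\<bar>(MIN u. a n u) - (MIN u. b u)\<bar> \<le> (\<Sum>u\<in>UNIV. \<bar>a n u - b u\<bar>)" for n
    by (rule abs_MIN_diff_le)
  then show "\<forall>\<^sub>F n in sequentially. norm ((MIN u. a n u) - (MIN u. b u)) \<le> (\<Sum>u\<in>UNIV. \<bar>a n u - b u\<bar>)"
    by simp
  show "(\<lambda>n. \<Sum>u\<in>UNIV. \<bar>a n u - b u\<bar>) \<longlonglongrightarrow> 0"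
    by (intro tendsto_null_sum tendsto_rabs_zero LIM_zero assms)
qed

section \<open>Passage from signed reals to extended nonnegative reals\<close>

lemma ennreal_max_0 [simp]: "ennreal (max 0 a) = ennreal a"
  by (simp add: max_def ennreal_neg)

lemma ennreal_add_le: "ennreal (a + b) \<le> ennreal a + ennreal b"
proof -
  have "ennreal (a + b) \<le> ennreal (max 0 a + max 0 b)" by (intro ennreal_leI) auto
  then show ?thesis by (simp add: ennreal_plus)
qed

text \<open>Truncating each term at 0 can only increase partial sums. The terms may have any sign
  and the series on the right may diverge.\<close>

lemma ennreal_sums_le:
  assumes "r sums s"
  shows "ennreal s \<le> (\<Sum>n. ennreal (r n))"
proof (rule LIMSEQ_le_const2)
  show "(\<lambda>n. ennreal (\<Sum>i<n. r i)) \<longlonglongrightarrow> ennreal s"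
    using assms unfolding sums_def by (rule tendsto_ennrealI)
  have "ennreal (\<Sum>i<n. r i) \<le> (\<Sum>i<n. ennreal (r i))" for n
    by (induction n) (auto intro: order_trans[OF ennreal_add_le] add_mono)
  also have "(\<Sum>i<n. ennreal (r i)) \<le> (\<Sum>i. ennreal (r i))" for n
    by (intro sum_le_suminf) auto
  finally show "\<exists>N. \<forall>n\<ge>N. ennreal (\<Sum>i<n. r i) \<le> (\<Sum>i. ennreal (r i))" by blast
qed

text \<open>The same truncation for integrals: \<open>g\<close> lies below its positive
  part.\<close>

lemma ennreal_integral_le_nn_integral:
  assumes "integrable N g"
  shows "ennreal (\<integral>x. g x \<partial>N) \<le> (\<integral>\<^sup>+x. ennreal (g x) \<partial>N)"
proof -
  have "ennreal (\<integral>x. g x \<partial>N) \<le> ennreal (\<integral>x. max 0 (g x) \<partial>N)"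
    using assms by (intro ennreal_leI integral_mono) auto
  also have "\<dots> = (\<integral>\<^sup>+x. ennreal (max 0 (g x)) \<partial>N)"
    using assms by (intro nn_integral_eq_integral[symmetric]) auto
  also have "\<dots> = (\<integral>\<^sup>+x. ennreal (g x) \<partial>N)" by simp
  finally show ?thesis .
qed

text \<open>\<open>K\<close> is an abstract bound on the cost, instantiated at the end with
  \<open>sup_norm_on X c\<close>.\<close>

locale markov_decision_process =
  fixes X :: "'x::topological_space set" and T :: "'x \<Rightarrow> 'u::finite \<Rightarrow> 'x measure"
    and c :: "'x \<Rightarrow> 'u \<Rightarrow> real" and \<beta> K :: real
  assumes kernel: "(\<lambda>(x, u). T x u) \<in> step_space X \<rightarrow>\<^sub>M prob_algebra (state_space X)"
    and cost_measurable: "\<And>u. (\<lambda>x. c x u) \<in> borel_measurable (state_space X)"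
    and cost_bound: "\<And>x u. x \<in> X \<Longrightarrow> \<bar>c x u\<bar> \<le> K"
    and discount: "0 < \<beta>" "\<beta> < 1"
begin

section \<open>Kernels, costs and one-step identities for trajectory laws\<close>

abbreviation "S \<equiv> state_space X"

lemma kernel_subprob [measurable]: "(\<lambda>(x, u). T x u) \<in> step_space X \<rightarrow>\<^sub>M subprob_algebra S"
  using kernel by (rule measurable_prob_algebraD)

lemma kernel_subprob1 [measurable]: "(\<lambda>x. T x u) \<in> S \<rightarrow>\<^sub>M subprob_algebra S"
  using measurable_compose[OF _ kernel_subprob, of "\<lambda>x. (x, u)" S] by simp

lemma space_S: "space S = X" by (simp add: space_restrict_space)

lemma T_prob: "x \<in> X \<Longrightarrow> prob_space (T x u)" and sets_T: "x \<in> X \<Longrightarrow> sets (T x u) = sets S"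
  using measurable_space[OF kernel, of "(x, u)"]
  by (auto simp: space_prob_algebra space_pair_measure space_restrict_space)

lemma space_T: "x \<in> X \<Longrightarrow> space (T x u) = X"
  using sets_eq_imp_space_eq[OF sets_T] space_S by simp

lemma cost_measurable_pair [measurable]: "(\<lambda>(x, u). c x u) \<in> borel_measurable (step_space X)"
  by (rule measurable_compose_countable'[where f="\<lambda>u p. c (fst p) u" and g=snd and I=UNIV,
        unfolded case_prod_beta[symmetric]])
     (auto intro: measurable_compose[OF measurable_fst cost_measurable] simp: countable_finite)

abbreviation law :: "'x measure \<Rightarrow> (nat \<Rightarrow> ('x, 'u) information \<Rightarrow> 'u measure) \<Rightarrow> (nat \<Rightarrow> 'x \<times> 'u) measure"
  where "law \<equiv> trajectory_law X T"

context
  fixes \<nu> :: "'x measure" and \<gamma> :: "nat \<Rightarrow> ('x, 'u) information \<Rightarrow> 'u measure"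
  assumes \<nu>: "\<nu> \<in> space (prob_algebra S)" and \<gamma>: "\<gamma> \<in> randomized_policies X"
begin

interpretation IT: Ionescu_Tulcea "step_kernel X T \<nu> \<gamma>" "\<lambda>_. step_space X"
  by (rule Ionescu_Tulcea_step_kernel[OF kernel \<nu> \<gamma>])

lemma sets_law: "sets (law \<nu> \<gamma>) = sets (PiM UNIV (\<lambda>_. step_space X))"
  unfolding trajectory_law_def by (rule IT.PF.sets_lim)

text \<open>The total mass is visible on the projection to no coordinates at all, which is a
  probability measure of the projective family.\<close>

lemma prob_space_law: "prob_space (law \<nu> \<gamma>)"
  unfolding trajectory_law_def
proof (rule prob_space_distrD)
  show "(\<lambda>\<omega>. restrict \<omega> {}) \<in> IT.PF.lim \<rightarrow>\<^sub>M PiM {} (\<lambda>_. step_space X)"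
    unfolding measurable_cong_sets[OF IT.PF.sets_lim refl] by (intro measurable_restrict_subset) simp
  show "prob_space (distr IT.PF.lim (PiM {} (\<lambda>_. step_space X)) (\<lambda>\<omega>. restrict \<omega> {}))"
    by (simp add: IT.distr_lim IT.PF.prob_space_P)
qed

lemma law_component [measurable]: "(\<lambda>\<omega>. \<omega> t) \<in> law \<nu> \<gamma> \<rightarrow>\<^sub>M step_space X"
  unfolding measurable_cong_sets[OF sets_law refl] by (rule measurable_component_singleton) simp

lemma law_state [measurable]: "(\<lambda>\<omega>. fst (\<omega> t)) \<in> law \<nu> \<gamma> \<rightarrow>\<^sub>M S"
  by (rule measurable_compose[OF law_component measurable_fst])

lemma nn_integral_step_kernel:
  assumes h[measurable]: "h \<in> borel_measurable (step_space X)"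
    and \<omega>: "\<omega> \<in> space (PiM {0..<t} (\<lambda>_. step_space X))"
  shows "(\<integral>\<^sup>+s. h s \<partial>step_kernel X T \<nu> \<gamma> t \<omega>) =
    (\<integral>\<^sup>+x. (\<integral>\<^sup>+u. h (x, u) \<partial>\<gamma> t (information t \<omega> x))
       \<partial>(if t = 0 then \<nu> else T (fst (\<omega> (t - 1))) (snd (\<omega> (t - 1)))))"
    (is "_ = integral\<^sup>N ?N _")
proof -
  have "sets ?N = sets S"
    using \<nu> sets_T[of "fst (\<omega> (t - 1))"] \<omega>
    by (auto simp: space_prob_algebra space_PiM PiE_iff space_pair_measure space_S mem_Times_iff)
  then have m: "measurable ?N A = measurable S A" for A :: "ennreal measure"
    by (rule measurable_cong_sets) simp
  have m': "measurable ?N A = measurable S A" for A :: "('x \<times> 'u) measure measure"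
    using \<open>sets ?N = sets S\<close> by (rule measurable_cong_sets) simp
  have sp: "space ?N = X" using sets_eq_imp_space_eq[OF \<open>sets ?N = sets S\<close>] space_S by simp
  have g: "\<gamma> t \<in> information_space X t \<rightarrow>\<^sub>M prob_algebra control_space"
    using \<gamma> by (simp add: randomized_policies_def)
  have \<gamma>m [measurable]: "(\<lambda>x. \<gamma> t (information t \<omega> x)) \<in> S \<rightarrow>\<^sub>M subprob_algebra control_space"
    by (rule measurable_prob_algebraD[OF measurable_compose[OF measurable_information[OF \<omega>] g]])
  have sets_\<gamma>: "sets (\<gamma> t (information t \<omega> x)) = sets control_space" if "x \<in> X" for x
    using measurable_space[OF \<gamma>m] that by (auto simp: space_S space_subprob_algebra)
  have inner: "(\<lambda>x. \<gamma> t (information t \<omega> x) \<bind> (\<lambda>u. return (step_space X) (x, u)))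
      \<in> S \<rightarrow>\<^sub>M subprob_algebra (step_space X)"
    by (rule measurable_bind[OF \<gamma>m]) measurable
  have "(\<integral>\<^sup>+s. h s \<partial>step_kernel X T \<nu> \<gamma> t \<omega>) =
    (\<integral>\<^sup>+x. (\<integral>\<^sup>+s. h s \<partial>(\<gamma> t (information t \<omega> x) \<bind> (\<lambda>u. return (step_space X) (x, u)))) \<partial>?N)"
    unfolding step_kernel_def
    by (rule nn_integral_bind[OF h]) (unfold m', rule inner)
  also have "\<dots> = (\<integral>\<^sup>+x. (\<integral>\<^sup>+u. h (x, u) \<partial>\<gamma> t (information t \<omega> x)) \<partial>?N)"
  proof (rule nn_integral_cong)
    fix x assume "x \<in> space ?N"
    then have x: "x \<in> X" by (simp add: sp)
    have "(\<lambda>u. return (step_space X) (x, u)) \<in> \<gamma> t (information t \<omega> x) \<rightarrow>\<^sub>M subprob_algebra (step_space X)"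
      unfolding measurable_cong_sets[OF sets_\<gamma>[OF x] refl]
      using x by (auto intro!: measurable_space[OF return_measurable] simp: space_pair_measure space_S)
    then show "(\<integral>\<^sup>+s. h s \<partial>(\<gamma> t (information t \<omega> x) \<bind> (\<lambda>u. return (step_space X) (x, u)))) =
        (\<integral>\<^sup>+u. h (x, u) \<partial>\<gamma> t (information t \<omega> x))"
      using x by (subst nn_integral_bind[OF h])
        (auto simp: nn_integral_return space_pair_measure space_S intro!: nn_integral_cong)
  qed
  finally show ?thesis .
qed

lemma nn_integral_law_step:
  assumes h[measurable]: "h \<in> borel_measurable (step_space X)"
  shows "(\<integral>\<^sup>+\<omega>. h (\<omega> t) \<partial>law \<nu> \<gamma>) =
    (\<integral>\<^sup>+\<omega>. (\<integral>\<^sup>+x. (\<integral>\<^sup>+u. h (x, u) \<partial>\<gamma> t (information t (restrict \<omega> {0..<t}) x))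
       \<partial>(if t = 0 then \<nu> else T (fst (\<omega> (t - 1))) (snd (\<omega> (t - 1))))) \<partial>law \<nu> \<gamma>)"
proof -
  have "(\<integral>\<^sup>+\<omega>. h (\<omega> t) \<partial>law \<nu> \<gamma>) =
     (\<integral>\<^sup>+\<omega>. (\<integral>\<^sup>+s. h s \<partial>step_kernel X T \<nu> \<gamma> t (restrict \<omega> {0..<t})) \<partial>law \<nu> \<gamma>)"
    unfolding trajectory_law_def by (rule IT.nn_integral_lim_component[OF h])
  also have "\<dots> = (\<integral>\<^sup>+\<omega>. (\<integral>\<^sup>+x. (\<integral>\<^sup>+u. h (x, u) \<partial>\<gamma> t (information t (restrict \<omega> {0..<t}) x))
       \<partial>(if t = 0 then \<nu> else T (fst (\<omega> (t - 1))) (snd (\<omega> (t - 1))))) \<partial>law \<nu> \<gamma>)"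
  proof (rule nn_integral_cong)
    fix \<omega> assume "\<omega> \<in> space (law \<nu> \<gamma>)"
    then have "restrict \<omega> {0..<t} \<in> space (PiM {0..<t} (\<lambda>_. step_space X))"
      using sets_eq_imp_space_eq[OF sets_law] by (auto simp: space_PiM PiE_iff)
    from nn_integral_step_kernel[OF h this]
    show "(\<integral>\<^sup>+s. h s \<partial>step_kernel X T \<nu> \<gamma> t (restrict \<omega> {0..<t})) =
      (\<integral>\<^sup>+x. (\<integral>\<^sup>+u. h (x, u) \<partial>\<gamma> t (information t (restrict \<omega> {0..<t}) x))
       \<partial>(if t = 0 then \<nu> else T (fst (\<omega> (t - 1))) (snd (\<omega> (t - 1)))))"
      \<comment> \<open>For \<open>t = 0\<close> no earlier coordinate is read; otherwise
        \<open>t - 1\<close> lies in the retained range, so the restriction of the trajectory makes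
        no difference.\<close>
      by (cases t) simp_all
  qed
  finally show ?thesis .
qed

lemma policy_prob_space:
  assumes "\<omega> \<in> space (law \<nu> \<gamma>)" "x \<in> X"
  shows "prob_space (\<gamma> t (information t (restrict \<omega> {0..<t}) x))"
proof -
  have "restrict \<omega> {0..<t} \<in> space (PiM {0..<t} (\<lambda>_. step_space X))"
    using assms sets_eq_imp_space_eq[OF sets_law] by (auto simp: space_PiM PiE_iff)
  from measurable_space[OF measurable_information[OF this], of x] assms
  have "information t (restrict \<omega> {0..<t}) x \<in> space (information_space X t)" by (simp add: space_S)
  moreover have "\<gamma> t \<in> information_space X t \<rightarrow>\<^sub>M prob_algebra control_space"
    using \<gamma> by (simp add: randomized_policies_def)
  ultimately have "\<gamma> t (information t (restrict \<omega> {0..<t}) x) \<in> space (prob_algebra control_space)"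
    by (rule measurable_space[rotated])
  then show ?thesis by (simp add: space_prob_algebra)
qed

lemma law_component_space: "\<omega> \<in> space (law \<nu> \<gamma>) \<Longrightarrow> fst (\<omega> t) \<in> X"
  using measurable_space[OF law_state] by (simp add: space_S)

text \<open>The control integrates out: its conditional law has mass 1 and the integrand ignores
  it.\<close>

lemma nn_integral_law_state:
  assumes h[measurable]: "h \<in> borel_measurable S"
  shows "(\<integral>\<^sup>+\<omega>. h (fst (\<omega> t)) \<partial>law \<nu> \<gamma>) =
    (\<integral>\<^sup>+\<omega>. (\<integral>\<^sup>+x. h x \<partial>(if t = 0 then \<nu> else T (fst (\<omega> (t - 1))) (snd (\<omega> (t - 1))))) \<partial>law \<nu> \<gamma>)"
proof -
  have sp: "space \<nu> = X"
    using \<nu> sets_eq_imp_space_eq[of \<nu> S] by (simp add: space_prob_algebra space_S)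
  have h': "(\<lambda>s. h (fst s)) \<in> borel_measurable (step_space X)" by measurable
  show ?thesis
    unfolding nn_integral_law_step[OF h', of t]
  proof (intro nn_integral_cong)
    fix \<omega> x
    assume \<omega>: "\<omega> \<in> space (law \<nu> \<gamma>)"
      and "x \<in> space (if t = 0 then \<nu> else T (fst (\<omega> (t - 1))) (snd (\<omega> (t - 1))))"
    then have "x \<in> X" by (simp add: sp space_T law_component_space split: if_splits)
    from prob_space.emeasure_space_1[OF policy_prob_space[OF \<omega> this]]
    show "(\<integral>\<^sup>+u. h (fst (x, u)) \<partial>\<gamma> t (information t (restrict \<omega> {0..<t}) x)) = h x" by simp
  qed
qed

lemma distr_law_0: "distr (law \<nu> \<gamma>) S (\<lambda>\<omega>. fst (\<omega> 0)) = \<nu>"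
proof (rule measure_eqI)
  interpret prob_space "law \<nu> \<gamma>" by (rule prob_space_law)
  fix A assume A: "A \<in> sets (distr (law \<nu> \<gamma>) S (\<lambda>\<omega>. fst (\<omega> 0)))"
  have "(\<integral>\<^sup>+x. indicator A x \<partial>distr (law \<nu> \<gamma>) S (\<lambda>\<omega>. fst (\<omega> 0))) = (\<integral>\<^sup>+x. indicator A x \<partial>\<nu>)"
    using A nn_integral_law_state[of "indicator A" 0]
    by (subst nn_integral_distr) (auto simp: emeasure_space_1)
  then show "emeasure (distr (law \<nu> \<gamma>) S (\<lambda>\<omega>. fst (\<omega> 0))) A = emeasure \<nu> A"
    using A \<nu> by (simp add: space_prob_algebra)
qed (use \<nu> in \<open>simp add: space_prob_algebra\<close>)

text \<open>The form with \<open>bind\<close> makes \<open>integral_bind\<close> applicable to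
  signed integrands in \<open>expectation_state_Suc\<close>.\<close>

lemma distr_law_Suc:
  "distr (law \<nu> \<gamma>) S (\<lambda>\<omega>. fst (\<omega> (Suc t))) = law \<nu> \<gamma> \<bind> (\<lambda>\<omega>. T (fst (\<omega> t)) (snd (\<omega> t)))"
proof (rule measure_eqI)
  interpret prob_space "law \<nu> \<gamma>" by (rule prob_space_law)
  have T: "(\<lambda>\<omega>. T (fst (\<omega> t)) (snd (\<omega> t))) \<in> law \<nu> \<gamma> \<rightarrow>\<^sub>M subprob_algebra S"
    using measurable_compose[OF law_component kernel_subprob] by (simp add: case_prod_beta)
  show "sets (distr (law \<nu> \<gamma>) S (\<lambda>\<omega>. fst (\<omega> (Suc t)))) =
      sets (law \<nu> \<gamma> \<bind> (\<lambda>\<omega>. T (fst (\<omega> t)) (snd (\<omega> t))))"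
    using sets_bind[of "law \<nu> \<gamma>" "\<lambda>\<omega>. T (fst (\<omega> t)) (snd (\<omega> t))" S] not_empty
    by (simp add: sets_T law_component_space)
  fix A assume A: "A \<in> sets (distr (law \<nu> \<gamma>) S (\<lambda>\<omega>. fst (\<omega> (Suc t))))"
  have "(\<integral>\<^sup>+x. indicator A x \<partial>distr (law \<nu> \<gamma>) S (\<lambda>\<omega>. fst (\<omega> (Suc t)))) =
     (\<integral>\<^sup>+\<omega>. (\<integral>\<^sup>+x. indicator A x \<partial>T (fst (\<omega> t)) (snd (\<omega> t))) \<partial>law \<nu> \<gamma>)"
    using A nn_integral_law_state[of "indicator A" "Suc t"]
    by (subst nn_integral_distr) auto
  also have "\<dots> = (\<integral>\<^sup>+\<omega>. emeasure (T (fst (\<omega> t)) (snd (\<omega> t))) A \<partial>law \<nu> \<gamma>)"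
    using A by (intro nn_integral_cong nn_integral_indicator) (simp add: sets_T law_component_space)
  also have "\<dots> = emeasure (law \<nu> \<gamma> \<bind> (\<lambda>\<omega>. T (fst (\<omega> t)) (snd (\<omega> t)))) A"
    using A by (subst emeasure_bind[OF not_empty T]) simp_all
  finally show "emeasure (distr (law \<nu> \<gamma>) S (\<lambda>\<omega>. fst (\<omega> (Suc t)))) A =
      emeasure (law \<nu> \<gamma> \<bind> (\<lambda>\<omega>. T (fst (\<omega> t)) (snd (\<omega> t)))) A"
    using A by simp
qed

lemma expectation_state_Suc:
  fixes v :: "'x \<Rightarrow> real"
  assumes v[measurable]: "v \<in> borel_measurable S" and bound: "\<And>x. x \<in> X \<Longrightarrow> \<bar>v x\<bar> \<le> L"
  shows "(\<integral>\<omega>. v (fst (\<omega> (Suc t))) \<partial>law \<nu> \<gamma>) =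
    (\<integral>\<omega>. (\<integral>x. v x \<partial>T (fst (\<omega> t)) (snd (\<omega> t))) \<partial>law \<nu> \<gamma>)"
proof -
  interpret prob_space "law \<nu> \<gamma>" by (rule prob_space_law)
  have T: "(\<lambda>\<omega>. T (fst (\<omega> t)) (snd (\<omega> t))) \<in> law \<nu> \<gamma> \<rightarrow>\<^sub>M subprob_algebra S"
    using measurable_compose[OF law_component kernel_subprob] by (simp add: case_prod_beta)
  have "(\<integral>\<omega>. v (fst (\<omega> (Suc t))) \<partial>law \<nu> \<gamma>) = (\<integral>x. v x \<partial>distr (law \<nu> \<gamma>) S (\<lambda>\<omega>. fst (\<omega> (Suc t))))"
    by (subst integral_distr) auto
  also have "\<dots> = (\<integral>\<omega>. (\<integral>x. v x \<partial>T (fst (\<omega> t)) (snd (\<omega> t))) \<partial>law \<nu> \<gamma>)"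
    unfolding distr_law_Suc
  proof (rule integral_bind[OF v _ T])
    show "AE \<omega> in law \<nu> \<gamma>. emeasure (T (fst (\<omega> t)) (snd (\<omega> t))) (space (T (fst (\<omega> t)) (snd (\<omega> t)))) \<le> ennreal 1"
      by (auto simp: prob_space.emeasure_space_1[OF T_prob] law_component_space)
  qed (use bound in \<open>auto simp: space_S finite_measure_axioms\<close>)
  finally show ?thesis .
qed

end

subsection \<open>Discounted costs and optimal stationary policies\<close>

text \<open>The one-step Bellman lookahead. For the function J of the overview it is
  \<open>A(x, u)\<close>.\<close>

definition action_value :: "('x \<Rightarrow> real) \<Rightarrow> 'x \<Rightarrow> 'u \<Rightarrow> real" where
  "action_value v x u = c x u + \<beta> * (\<integral>z. v z \<partial>T x u)"

lemma action_value_measurable_pair: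
  assumes "v \<in> borel_measurable S"
  shows "(\<lambda>(x, u). action_value v x u) \<in> borel_measurable (step_space X)"
proof -
  have "(\<lambda>p. \<integral>z. v z \<partial>(case p of (x, u) \<Rightarrow> T x u)) \<in> borel_measurable (step_space X)"
    by (rule measurable_compose[OF kernel_subprob integral_measurable_subprob_algebra[OF assms]])
  then show ?thesis
    using cost_measurable_pair unfolding action_value_def case_prod_beta by measurable
qed

lemma action_value_measurable:
  assumes "v \<in> borel_measurable S"
  shows "(\<lambda>x. action_value v x u) \<in> borel_measurable S"
  using measurable_compose[OF _ action_value_measurable_pair[OF assms], of "\<lambda>x. (x, u)" S] by simp

lemma integrable_T:
  assumes "v \<in> borel_measurable S" "\<And>x. x \<in> X \<Longrightarrow> \<bar>v x\<bar> \<le> L" "x \<in> X"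
  shows "integrable (T x u) (v :: 'x \<Rightarrow> real)"
proof -
  interpret prob_space "T x u" using assms by (simp add: T_prob)
  show ?thesis
    using assms(1) by (intro integrable_const_bound[of _ L])
      (auto simp: assms(2) space_T[OF assms(3)] measurable_cong_sets[OF sets_T[OF assms(3)] refl])
qed

lemma abs_integral_T_le:
  assumes "v \<in> borel_measurable S" "\<And>x. x \<in> X \<Longrightarrow> \<bar>v x\<bar> \<le> L" "x \<in> X"
  shows "\<bar>\<integral>z. v z \<partial>T x u\<bar> \<le> (L :: real)"
proof -
  interpret prob_space "T x u" using assms by (simp add: T_prob)
  have "\<bar>\<integral>z. v z \<partial>T x u\<bar> \<le> (\<integral>z. \<bar>v z\<bar> \<partial>T x u)" by (rule integral_abs_bound)
  also have "\<dots> \<le> (\<integral>z. L \<partial>T x u)"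
    using integrable_T[OF assms] assms by (intro integral_mono) (auto simp: space_T)
  finally show ?thesis by (simp add: prob_space)
qed

lemma abs_action_value_le:
  assumes "v \<in> borel_measurable S" "\<And>x. x \<in> X \<Longrightarrow> \<bar>v x\<bar> \<le> L" "x \<in> X"
  shows "\<bar>action_value v x u\<bar> \<le> K + \<beta> * L"
proof -
  have "\<bar>\<beta> * (\<integral>z. v z \<partial>T x u)\<bar> \<le> \<beta> * L"
    using abs_integral_T_le[OF assms] discount by (simp add: abs_mult)
  then show ?thesis unfolding action_value_def using cost_bound[OF assms(3), of u] by linarith
qed

lemma point_mass: "x0 \<in> X \<Longrightarrow> return S x0 \<in> space (prob_algebra S)"
  by (auto simp: space_prob_algebra intro!: prob_space_return simp: space_S)

lemma integrable_law:
  fixes h :: "'x \<times> 'u \<Rightarrow> real"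
  assumes "\<nu> \<in> space (prob_algebra S)" "\<gamma> \<in> randomized_policies X"
    and "h \<in> borel_measurable (step_space X)" "\<And>x u. x \<in> X \<Longrightarrow> \<bar>h (x, u)\<bar> \<le> L"
  shows "integrable (law \<nu> \<gamma>) (\<lambda>\<omega>. h (\<omega> t))" and "\<bar>\<integral>\<omega>. h (\<omega> t) \<partial>law \<nu> \<gamma>\<bar> \<le> L"
proof -
  interpret prob_space "law \<nu> \<gamma>" using assms by (simp add: prob_space_law)
  have b: "\<bar>h (\<omega> t)\<bar> \<le> L" if "\<omega> \<in> space (law \<nu> \<gamma>)" for \<omega>
    using law_component_space[OF assms(1,2) that, of t] assms(4)[of "fst (\<omega> t)" "snd (\<omega> t)"] by simp
  show i: "integrable (law \<nu> \<gamma>) (\<lambda>\<omega>. h (\<omega> t))"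
    by (intro integrable_const_bound[of _ L] measurable_compose[OF law_component[OF assms(1,2)] assms(3)])
       (simp add: b)
  have "\<bar>\<integral>\<omega>. h (\<omega> t) \<partial>law \<nu> \<gamma>\<bar> \<le> (\<integral>\<omega>. \<bar>h (\<omega> t)\<bar> \<partial>law \<nu> \<gamma>)" by (rule integral_abs_bound)
  also have "\<dots> \<le> (\<integral>\<omega>. L \<partial>law \<nu> \<gamma>)" using i b by (intro integral_mono) auto
  finally show "\<bar>\<integral>\<omega>. h (\<omega> t) \<partial>law \<nu> \<gamma>\<bar> \<le> L" by (simp add: prob_space)
qed

lemma summable_discount: "summable (\<lambda>t. \<beta> ^ t * L)"
  using discount by (intro summable_mult2 summable_geometric) simp

text \<open>Each summand is E[c] + \<beta> E[v(X_{t+1})] - E[v(X_t)], so the weights \<beta>^t make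
  the \<open>v\<close>-terms telescope to -v(x0). Arbitrary policies and arbitrary bounded
  \<open>v\<close> are allowed, as it is applied both to J and to the optimal value
  function.\<close>

lemma performance_difference:
  assumes \<gamma>: "\<gamma> \<in> randomized_policies X" and x0: "x0 \<in> X"
    and v: "v \<in> borel_measurable S" and bound: "\<And>x. x \<in> X \<Longrightarrow> \<bar>v x\<bar> \<le> L"
  shows "(\<lambda>t. \<beta> ^ t * (\<integral>\<omega>. action_value v (fst (\<omega> t)) (snd (\<omega> t)) - v (fst (\<omega> t)) \<partial>law (return S x0) \<gamma>))
    sums (discounted_cost X T c \<beta> \<gamma> x0 - v x0)"
proof -
  let ?P = "law (return S x0) \<gamma>"
  note \<nu> = point_mass[OF x0]
  interpret prob_space ?P by (rule prob_space_law[OF \<nu> \<gamma>])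
  define a where "a t = (\<integral>\<omega>. c (fst (\<omega> t)) (snd (\<omega> t)) \<partial>?P)" for t
  define b where "b t = (\<integral>\<omega>. v (fst (\<omega> t)) \<partial>?P)" for t
  have ci: "integrable ?P (\<lambda>\<omega>. c (fst (\<omega> t)) (snd (\<omega> t)))" for t
    using integrable_law(1)[OF \<nu> \<gamma> cost_measurable_pair, of K] cost_bound by (simp add: case_prod_beta)
  have vm: "(\<lambda>p. v (fst p)) \<in> borel_measurable (step_space X)"
    using v by measurable
  have vi: "integrable ?P (\<lambda>\<omega>. v (fst (\<omega> t)))" and b_le: "\<bar>b t\<bar> \<le> L" for t
    using integrable_law[OF \<nu> \<gamma> vm, of L] bound unfolding b_def by auto
  have Tm: "(\<lambda>p. \<integral>z. v z \<partial>(case p of (x, u) \<Rightarrow> T x u)) \<in> borel_measurable (step_space X)"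
    by (rule measurable_compose[OF kernel_subprob integral_measurable_subprob_algebra[OF v]])
  have Ti: "integrable ?P (\<lambda>\<omega>. \<integral>z. v z \<partial>T (fst (\<omega> t)) (snd (\<omega> t)))" for t
    using integrable_law(1)[OF \<nu> \<gamma> Tm, of L] abs_integral_T_le[OF v bound] by (simp add: case_prod_beta)
  \<comment> \<open>Sum and expectation are exchanged with the geometric majorant
    \<open>\<beta> ^ t * K\<close>.\<close>
  have "(\<lambda>t. \<integral>\<omega>. \<beta> ^ t * c (fst (\<omega> t)) (snd (\<omega> t)) \<partial>?P) sums discounted_cost X T c \<beta> \<gamma> x0"
    unfolding discounted_cost_def
  proof (rule sums_integral)
    show "integrable ?P (\<lambda>\<omega>. \<beta> ^ t * c (fst (\<omega> t)) (snd (\<omega> t)))" for t using ci by simp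
    have cb: "norm (\<beta> ^ t * c (fst (\<omega> t)) (snd (\<omega> t))) \<le> \<beta> ^ t * K" if "\<omega> \<in> space ?P" for \<omega> t
      using discount cost_bound[OF law_component_space[OF \<nu> \<gamma> that]]
      by (auto simp: abs_mult intro!: mult_left_mono)
    show "AE \<omega> in ?P. summable (\<lambda>t. norm (\<beta> ^ t * c (fst (\<omega> t)) (snd (\<omega> t))))"
      using cb by (intro AE_I2 summable_comparison_test'[OF summable_discount[of K], of 0]) auto
    have "(\<integral>\<omega>. norm (\<beta> ^ t * c (fst (\<omega> t)) (snd (\<omega> t))) \<partial>?P) \<le> \<beta> ^ t * K" for t
    proof -
      have "(\<integral>\<omega>. norm (\<beta> ^ t * c (fst (\<omega> t)) (snd (\<omega> t))) \<partial>?P) \<le> (\<integral>\<omega>. \<beta> ^ t * K \<partial>?P)"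
        using ci cb by (intro integral_mono integrable_norm) auto
      then show ?thesis by (simp add: prob_space)
    qed
    then show "summable (\<lambda>t. \<integral>\<omega>. norm (\<beta> ^ t * c (fst (\<omega> t)) (snd (\<omega> t))) \<partial>?P)"
      by (intro summable_comparison_test'[OF summable_discount[of K], of 0]) auto
  qed
  then have cost: "(\<lambda>t. \<beta> ^ t * a t) sums discounted_cost X T c \<beta> \<gamma> x0"
    by (simp add: a_def)
  have b0: "b 0 = v x0"
  proof -
    have "b 0 = (\<integral>x. v x \<partial>distr ?P S (\<lambda>\<omega>. fst (\<omega> 0)))"
      unfolding b_def using law_state[OF \<nu> \<gamma>] v by (subst integral_distr) auto
    then show ?thesis using v x0 by (simp add: distr_law_0[OF \<nu> \<gamma>] integral_return space_S)
  qed
  \<comment> \<open>The boundary term at infinity of the telescoping sum vanishes because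
    \<open>v\<close> is bounded.\<close>
  have "(\<lambda>t. \<beta> ^ t * b t) \<longlonglongrightarrow> 0"
  proof (rule Lim_null_comparison)
    show "\<forall>\<^sub>F t in sequentially. norm (\<beta> ^ t * b t) \<le> \<beta> ^ t * L"
      using discount b_le by (auto simp: abs_mult intro!: mult_left_mono)
    show "(\<lambda>t. \<beta> ^ t * L) \<longlonglongrightarrow> 0" by (rule summable_LIMSEQ_zero[OF summable_discount])
  qed
  from telescope_sums[OF this]
  have "(\<lambda>t. \<beta> ^ Suc t * b (Suc t) - \<beta> ^ t * b t) sums (- v x0)" by (simp add: b0)
  from sums_add[OF cost this]
  have "(\<lambda>t. \<beta> ^ t * (a t + \<beta> * b (Suc t) - b t)) sums (discounted_cost X T c \<beta> \<gamma> x0 - v x0)"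
    by (simp add: algebra_simps)
  \<comment> \<open>Here the transition kernel enters: given step \<open>t\<close>, the mean of
    \<open>v\<close> at the next state is its integral against \<open>T\<close>.\<close>
  moreover have "a t + \<beta> * b (Suc t) - b t =
      (\<integral>\<omega>. action_value v (fst (\<omega> t)) (snd (\<omega> t)) - v (fst (\<omega> t)) \<partial>?P)" for t
    using ci vi Ti expectation_state_Suc[OF \<nu> \<gamma> v bound, of t]
    unfolding a_def b_def action_value_def by simp
  ultimately show ?thesis by simp
qed

text \<open>A point mass at \<open>f x\<close> gives no mass to controls different from
  \<open>f x\<close>. The trajectory space contains all sequences, so the control can be replaced by
  \<open>f\<close> only almost surely.\<close>

lemma stationary_law_control:
  assumes f: "f \<in> S \<rightarrow>\<^sub>M control_space" and \<nu>: "\<nu> \<in> space (prob_algebra S)"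
  shows "AE \<omega> in law \<nu> (deterministic (stationary f)). snd (\<omega> t) = f (fst (\<omega> t))"
proof -
  let ?g = "deterministic (stationary f) :: nat \<Rightarrow> ('x, 'u) information \<Rightarrow> 'u measure"
  have g: "?g \<in> randomized_policies X"
    by (intro deterministic_randomized stationary_admissible f)
  note [measurable] = f law_component[OF \<nu> g]
  define h where "h p = (indicator {p. snd p \<noteq> f (fst p)} p :: ennreal)" for p
  have hm: "h \<in> borel_measurable (step_space X)"
    unfolding h_def by measurable
  have "(\<integral>\<^sup>+\<omega>. h (\<omega> t) \<partial>law \<nu> ?g) = 0"
    unfolding nn_integral_law_step[OF \<nu> g hm]
    by (simp add: deterministic_def stationary_def information_def nn_integral_return h_def)
  moreover have "(\<lambda>\<omega>. h (\<omega> t)) \<in> borel_measurable (law \<nu> ?g)"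
    by (rule measurable_compose[OF law_component[OF \<nu> g] hm])
  ultimately have "AE \<omega> in law \<nu> ?g. h (\<omega> t) = 0" by (simp add: nn_integral_0_iff_AE)
  then show ?thesis by eventually_elim (auto simp: h_def split: split_indicator_asm)
qed

text \<open>\<open>s\<close> is 1 or -1 in all uses, for costs above and below \<open>v\<close>. The
  majorant \<open>d\<close> is \<open>ennreal\<close> valued so that it may have infinite
  expectation; the inequality is required only at the controls that \<open>f\<close> takes.\<close>

lemma policy_gap:
  assumes f: "f \<in> S \<rightarrow>\<^sub>M control_space" and x0: "x0 \<in> X"
    and v: "v \<in> borel_measurable S" and bound: "\<And>x. x \<in> X \<Longrightarrow> \<bar>v x\<bar> \<le> L"
    and le: "\<And>x. x \<in> X \<Longrightarrow> ennreal (s * (action_value v x (f x) - v x)) \<le> d x"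
  shows "ennreal (s * (discounted_cost X T c \<beta> (deterministic (stationary f)) x0 - v x0))
    \<le> (\<Sum>t. ennreal (\<beta> ^ t) *
        (\<integral>\<^sup>+\<omega>. d (fst (\<omega> t)) \<partial>law (return S x0) (deterministic (stationary f))))"
proof -
  let ?g = "deterministic (stationary f) :: nat \<Rightarrow> ('x, 'u) information \<Rightarrow> 'u measure"
  let ?P = "law (return S x0) ?g"
  note \<nu> = point_mass[OF x0]
  have g: "?g \<in> randomized_policies X"
    by (intro deterministic_randomized stationary_admissible f)
  let ?h = "\<lambda>p. action_value v (fst p) (snd p) - v (fst p)"
  have hm: "?h \<in> borel_measurable (step_space X)"
    using action_value_measurable_pair[OF v] v by (simp add: case_prod_beta)
  have hb: "\<bar>?h (x, u)\<bar> \<le> (K + \<beta> * L) + L" if "x \<in> X" for x u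
    using abs_action_value_le[OF v bound that, of u] bound[OF that] by simp
  have int: "integrable ?P (\<lambda>\<omega>. ?h (\<omega> t))" for t
    by (rule integrable_law(1)[OF \<nu> g hm hb])
  have gap: "ennreal (s * (\<integral>\<omega>. ?h (\<omega> t) \<partial>?P)) \<le> (\<integral>\<^sup>+\<omega>. d (fst (\<omega> t)) \<partial>?P)" for t
  proof -
    have "ennreal (s * (\<integral>\<omega>. ?h (\<omega> t) \<partial>?P)) = ennreal (\<integral>\<omega>. s * ?h (\<omega> t) \<partial>?P)" by simp
    also have "\<dots> \<le> (\<integral>\<^sup>+\<omega>. ennreal (s * ?h (\<omega> t)) \<partial>?P)"
      using int by (intro ennreal_integral_le_nn_integral) simp
    also have "\<dots> \<le> (\<integral>\<^sup>+\<omega>. d (fst (\<omega> t)) \<partial>?P)"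
    proof (rule nn_integral_mono_AE)
      show "AE \<omega> in ?P. ennreal (s * ?h (\<omega> t)) \<le> d (fst (\<omega> t))"
        using stationary_law_control[OF f \<nu>, of t] AE_space
        by eventually_elim (use le law_component_space[OF \<nu> g] in auto)
    qed
    finally show ?thesis .
  qed
  have "ennreal (s * (discounted_cost X T c \<beta> ?g x0 - v x0)) \<le>
      (\<Sum>t. ennreal (s * (\<beta> ^ t * (\<integral>\<omega>. ?h (\<omega> t) \<partial>?P))))"
    by (intro ennreal_sums_le sums_mult performance_difference[OF g x0 v bound])
  also have "\<dots> \<le> (\<Sum>t. ennreal (\<beta> ^ t) * (\<integral>\<^sup>+\<omega>. d (fst (\<omega> t)) \<partial>?P))"
  proof (intro suminf_le summableI)
    fix t
    have "ennreal (s * (\<beta> ^ t * (\<integral>\<omega>. ?h (\<omega> t) \<partial>?P))) =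
        ennreal (\<beta> ^ t) * ennreal (s * (\<integral>\<omega>. ?h (\<omega> t) \<partial>?P))"
      using discount by (subst ennreal_mult'[symmetric]) (auto simp: mult_ac)
    also have "\<dots> \<le> ennreal (\<beta> ^ t) * (\<integral>\<^sup>+\<omega>. d (fst (\<omega> t)) \<partial>?P)"
      by (intro mult_left_mono gap) simp
    finally show "ennreal (s * (\<beta> ^ t * (\<integral>\<omega>. ?h (\<omega> t) \<partial>?P))) \<le>
        ennreal (\<beta> ^ t) * (\<integral>\<^sup>+\<omega>. d (fst (\<omega> t)) \<partial>?P)" .
  qed
  finally show ?thesis .
qed

text \<open>\<open>measure_of\<close> returns the prescribed set function only if that is countably
  additive. This is seen by exhibiting it as a genuine measure \<open>N\<close>: the law of the
  state at an independent geometric time.\<close>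

lemma nn_integral_occupation_measure:
  assumes x0: "x0 \<in> X" and g: "g \<in> randomized_policies X" and d: "d \<in> borel_measurable S"
  shows "(\<integral>\<^sup>+x. d x \<partial>occupation_measure X T \<beta> g x0) =
    ennreal (1 - \<beta>) * (\<Sum>t. ennreal (\<beta> ^ t) * (\<integral>\<^sup>+\<omega>. d (fst (\<omega> t)) \<partial>law (return S x0) g))"
    and "sets (occupation_measure X T \<beta> g x0) = sets S"
    and "prob_space (occupation_measure X T \<beta> g x0)"
proof -
  let ?P = "law (return S x0) g"
  note \<nu> = point_mass[OF x0]
  interpret prob_space ?P by (rule prob_space_law[OF \<nu> g])
  \<comment> \<open>The geometric law on times, with weight (1 - \<beta>) \<beta>^t at
    \<open>t\<close>.\<close>
  define D where "D = density (count_space UNIV) (\<lambda>t. ennreal (1 - \<beta>) * ennreal (\<beta> ^ t))"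
  define N where "N = D \<bind> (\<lambda>t. distr ?P S (\<lambda>\<omega>. fst (\<omega> t)))"
  note law_state[OF \<nu> g, measurable]
  have kernel: "(\<lambda>t. distr ?P S (\<lambda>\<omega>. fst (\<omega> t))) \<in> D \<rightarrow>\<^sub>M subprob_algebra S"
    unfolding D_def
    by (auto simp: measurable_def space_subprob_algebra intro!: prob_space_imp_subprob_space prob_space_distr
      dest: measurable_space[OF law_state[OF \<nu> g]])
  have sets_N: "sets N = sets S"
    unfolding N_def by (rule sets_bind) (auto simp: D_def)
  have N: "(\<integral>\<^sup>+x. d x \<partial>N) = ennreal (1 - \<beta>) * (\<Sum>t. ennreal (\<beta> ^ t) * (\<integral>\<^sup>+\<omega>. d (fst (\<omega> t)) \<partial>?P))"
    if d: "d \<in> borel_measurable S" for d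
  proof -
    have "(\<integral>\<^sup>+x. d x \<partial>N) = (\<integral>\<^sup>+t. (\<integral>\<^sup>+\<omega>. d (fst (\<omega> t)) \<partial>?P) \<partial>D)"
      unfolding N_def nn_integral_bind[OF d kernel] using d by (simp add: nn_integral_distr)
    also have "\<dots> = (\<Sum>t. ennreal (1 - \<beta>) * (ennreal (\<beta> ^ t) * (\<integral>\<^sup>+\<omega>. d (fst (\<omega> t)) \<partial>?P)))"
      unfolding D_def by (simp add: nn_integral_density nn_integral_count_space_nat mult.assoc)
    finally show ?thesis by simp
  qed
  have "occupation_measure X T \<beta> g x0 = measure_of (space N) (sets N) (emeasure N)"
    unfolding occupation_measure_def Let_def sets_N sets_eq_imp_space_eq[OF sets_N] space_S
  proof (rule measure_of_eq)
    show "sets S \<subseteq> Pow X" using sets.space_closed[of S] by (simp add: space_S)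
    fix A assume "A \<in> sigma_sets X (sets S)"
    then have A: "A \<in> sets S" using sets.sigma_sets_eq[of S] by (simp add: space_S)
    have "(\<integral>\<^sup>+\<omega>. indicator A (fst (\<omega> t)) \<partial>?P) = emeasure ?P {\<omega> \<in> space ?P. fst (\<omega> t) \<in> A}" for t
    proof -
      have "(\<integral>\<^sup>+\<omega>. indicator A (fst (\<omega> t)) \<partial>?P) =
          (\<integral>\<^sup>+\<omega>. indicator {\<omega> \<in> space ?P. fst (\<omega> t) \<in> A} \<omega> \<partial>?P)"
        by (intro nn_integral_cong) (simp add: indicator_def)
      also have "\<dots> = emeasure ?P {\<omega> \<in> space ?P. fst (\<omega> t) \<in> A}"
        using measurable_sets[OF law_state[OF \<nu> g] A, of t]
        by (intro nn_integral_indicator) (simp add: vimage_def Int_def conj_commute)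
      finally show ?thesis .
    qed
    with N[of "indicator A"] A sets_N
    show "ennreal (1 - \<beta>) * (\<Sum>t. ennreal (\<beta> ^ t) * emeasure ?P {\<omega> \<in> space ?P. fst (\<omega> t) \<in> A}) = emeasure N A"
      by simp
  qed
  then have eq: "occupation_measure X T \<beta> g x0 = N" by (simp add: measure_of_of_measure)
  show "(\<integral>\<^sup>+x. d x \<partial>occupation_measure X T \<beta> g x0) =
      ennreal (1 - \<beta>) * (\<Sum>t. ennreal (\<beta> ^ t) * (\<integral>\<^sup>+\<omega>. d (fst (\<omega> t)) \<partial>?P))"
    unfolding eq by (rule N[OF d])
  show "sets (occupation_measure X T \<beta> g x0) = sets S" unfolding eq by (rule sets_N)
  show "prob_space (occupation_measure X T \<beta> g x0)"
    unfolding eq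
  proof
    have "(\<Sum>t. ennreal (\<beta> ^ t)) = ennreal (1 / (1 - \<beta>))"
      using discount by (subst suminf_ennreal_eq[where x="1 / (1 - \<beta>)"]) (auto intro!: geometric_sums)
    then show "emeasure N (space N) = 1"
      using N[of "\<lambda>_. 1"] discount by (simp add: emeasure_space_1 ennreal_mult'[symmetric])
  qed
qed

text \<open>Value iteration from 0: successive iterates differ by at most
  \<open>\<beta> ^ n * L\<close>, so they converge at each point of \<open>X\<close>. A pointwise
  limit inherits measurability, and dominated convergence moves it through \<open>T\<close>.\<close>

lemma bellman_fixed_point:
  obtains v where "v \<in> borel_measurable S" "\<And>x. x \<in> X \<Longrightarrow> \<bar>v x\<bar> \<le> K / (1 - \<beta>)"
    "\<And>x. x \<in> X \<Longrightarrow> v x = (MIN u. action_value v x u)"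
proof -
  define L where "L = K / (1 - \<beta>)"
  \<comment> \<open>\<open>L\<close> is the fixed point of the bound recursion, hence all iterates
    obey the same bound.\<close>
  have L: "K + \<beta> * L = L" using discount by (simp add: L_def field_simps)
  define w where "w n = ((\<lambda>v x. MIN u. action_value v x u) ^^ n) (\<lambda>_. 0)" for n
  have w0: "w 0 x = 0" and wSuc: "w (Suc n) x = (MIN u. action_value (w n) x u)" for n x
    by (simp_all add: w_def)
  have wm: "w n \<in> borel_measurable S" for n
  proof (induction n)
    case (Suc n)
    then show ?case unfolding wSuc[abs_def] by (intro borel_measurable_Min action_value_measurable) auto
  qed (simp add: w0[abs_def])
  have wb: "\<bar>w n x\<bar> \<le> L" if "x \<in> X" for n x
    using that
  proof (induction n arbitrary: x)
    case 0
    then show ?case using cost_bound[of x] discount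
      by (auto simp: w0 L_def intro!: divide_nonneg_pos intro: order_trans[OF abs_ge_zero])
  next
    case (Suc n)
    show ?case unfolding wSuc
      using abs_action_value_le[OF wm Suc.IH] Suc.prems by (intro abs_MIN_le) (simp add: L)
  qed
  have step: "\<bar>w (Suc n) x - w n x\<bar> \<le> \<beta> ^ n * L" if "x \<in> X" for n x
    using that
  proof (induction n arbitrary: x)
    case 0
    then show ?case using wb[of x 1] by (simp add: w0)
  next
    case (Suc n)
    show ?case unfolding wSuc[of "Suc n" x] wSuc[of n x]
    proof (rule abs_MIN_diff_le)
      fix u
      have "\<bar>\<integral>z. w (Suc n) z - w n z \<partial>T x u\<bar> \<le> \<beta> ^ n * L"
        using Suc.prems wm by (intro abs_integral_T_le Suc.IH) auto
      then have "\<beta> * \<bar>\<integral>z. w (Suc n) z - w n z \<partial>T x u\<bar> \<le> \<beta> * (\<beta> ^ n * L)"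
        using discount by simp
      then show "\<bar>action_value (w (Suc n)) x u - action_value (w n) x u\<bar> \<le> \<beta> ^ Suc n * L"
        using integrable_T[OF wm wb Suc.prems] discount
        by (simp add: action_value_def abs_mult flip: right_diff_distrib)
    qed
  qed
  define v where "v x = lim (\<lambda>n. w n x)" for x
  have lim: "(\<lambda>n. w n x) \<longlonglongrightarrow> v x" if "x \<in> X" for x
  proof -
    \<comment> \<open>The partial sums of the increments are the iterates themselves, as
      \<open>w 0\<close> vanishes.\<close>
    have "summable (\<lambda>n. w (Suc n) x - w n x)"
      using step[OF that] by (intro summable_comparison_test'[OF summable_discount[of L], of 0]) simp
    then have "convergent (\<lambda>n. w n x)"
      by (simp add: summable_iff_convergent sum_lessThan_telescope[of "\<lambda>n. w n x"] w0)
    then show ?thesis unfolding v_def by (simp add: convergent_LIMSEQ_iff)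
  qed
  have vm: "v \<in> borel_measurable S"
    unfolding v_def[abs_def] using wm by (rule borel_measurable_lim_metric)
  have vb: "\<bar>v x\<bar> \<le> L" if "x \<in> X" for x
    using wb[OF that] by (intro LIMSEQ_le_const2[OF tendsto_rabs[OF lim[OF that]]]) auto
  have "v x = (MIN u. action_value v x u)" if x: "x \<in> X" for x
  proof (rule LIMSEQ_unique)
    show "(\<lambda>n. w (Suc n) x) \<longlonglongrightarrow> v x" by (rule LIMSEQ_Suc[OF lim[OF x]])
    have "(\<lambda>n. \<integral>z. w n z \<partial>T x u) \<longlonglongrightarrow> (\<integral>z. v z \<partial>T x u)" for u
    proof (rule integral_dominated_convergence)
      interpret prob_space "T x u" by (rule T_prob[OF x])
      show "integrable (T x u) (\<lambda>_. L)" by simp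
    qed (use wm vm wb lim in \<open>auto simp: measurable_cong_sets[OF sets_T[OF x] refl] space_T[OF x]\<close>)
    then show "(\<lambda>n. w (Suc n) x) \<longlonglongrightarrow> (MIN u. action_value v x u)"
      unfolding wSuc action_value_def by (intro tendsto_MIN tendsto_intros)
  qed
  with vm vb show thesis using that unfolding L_def by blast
qed

text \<open>All terms of the performance difference are nonnegative, however the policy depends on
  the past.\<close>

lemma discounted_cost_ge:
  assumes \<gamma>: "\<gamma> \<in> randomized_policies X" and x0: "x0 \<in> X"
    and v: "v \<in> borel_measurable S" and bound: "\<And>x. x \<in> X \<Longrightarrow> \<bar>v x\<bar> \<le> L"
    and le: "\<And>x u. x \<in> X \<Longrightarrow> v x \<le> action_value v x u"
  shows "v x0 \<le> discounted_cost X T c \<beta> \<gamma> x0"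
proof -
  have "0 \<le> discounted_cost X T c \<beta> \<gamma> x0 - v x0"
    using discount
    by (intro sums_le[OF _ sums_zero performance_difference[OF \<gamma> x0 v bound]] mult_nonneg_nonneg
        integral_nonneg_AE AE_I2) (auto simp: le law_component_space[OF point_mass[OF x0] \<gamma>])
  then show ?thesis by simp
qed

text \<open>A verification argument: the Bellman fixed point is a lower bound for every admissible
  policy and is attained by its greedy selector. The lower bound also makes the real-valued
  \<open>INF\<close> bounded below, which the last conclusion requires.\<close>

lemma optimal_stationary_policy:
  assumes x0: "x0 \<in> X"
  obtains f where "f \<in> S \<rightarrow>\<^sub>M control_space"
    "optimal_cost X T c \<beta> x0 = discounted_cost X T c \<beta> (deterministic (stationary f)) x0"
    "\<And>f'. f' \<in> S \<rightarrow>\<^sub>M control_space \<Longrightarrow>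
       optimal_cost X T c \<beta> x0 \<le> discounted_cost X T c \<beta> (deterministic (stationary f')) x0"
proof -
  obtain v where v: "v \<in> borel_measurable S" and bound: "\<And>x. x \<in> X \<Longrightarrow> \<bar>v x\<bar> \<le> K / (1 - \<beta>)"
    and fp: "\<And>x. x \<in> X \<Longrightarrow> v x = (MIN u. action_value v x u)"
    by (rule bellman_fixed_point) blast
  obtain f where f: "f \<in> S \<rightarrow>\<^sub>M control_space" and greedy: "\<And>x. action_value v x (f x) = (MIN u. action_value v x u)"
    by (rule measurable_greedy_selector[of "action_value v", OF action_value_measurable[OF v]]) blast
  have ge: "v x0 \<le> discounted_cost X T c \<beta> (deterministic g) x0" if "g \<in> admissible_policies X" for g
    using that by (intro discounted_cost_ge[OF deterministic_randomized x0 v bound]) (auto simp: fp)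
  then have bdd: "bdd_below ((\<lambda>g. discounted_cost X T c \<beta> (deterministic g) x0) ` admissible_policies X)"
    by (intro bdd_belowI2)
  have le: "optimal_cost X T c \<beta> x0 \<le> discounted_cost X T c \<beta> (deterministic (stationary f')) x0"
    if "f' \<in> S \<rightarrow>\<^sub>M control_space" for f'
    unfolding optimal_cost_def using that by (intro cINF_lower[OF bdd] stationary_admissible)
  \<comment> \<open>Along the greedy selector the one-step gap is zero, so \<open>d\<close> is 0; a
    truncated real that is at most 0 comes from a nonpositive real.\<close>
  have "ennreal (1 * (discounted_cost X T c \<beta> (deterministic (stationary f)) x0 - v x0))
    \<le> (\<Sum>t. ennreal (\<beta> ^ t) * (\<integral>\<^sup>+\<omega>. 0 \<partial>law (return S x0) (deterministic (stationary f))))"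
    by (rule policy_gap[OF f x0 v bound]) (simp_all add: greedy fp)
  then have "discounted_cost X T c \<beta> (deterministic (stationary f)) x0 \<le> v x0"
    by (simp add: ennreal_eq_0_iff)
  also have "v x0 \<le> optimal_cost X T c \<beta> x0"
    unfolding optimal_cost_def using ge stationary_admissible[OF f] by (intro cINF_greatest) auto
  finally show thesis using that[OF f] le by (meson f antisym)
qed

end

subsection \<open>Quantization\<close>

lemma integral_uniform_measure:
  fixes h :: "'a \<Rightarrow> real"
  assumes "finite_measure N" and A: "A \<in> sets N" and pos: "measure N A > 0"
    and h: "h \<in> borel_measurable N"
  shows "(\<integral>x. h x \<partial>uniform_measure N A) = 1 / measure N A * (LINT x:A|N. h x)"
proof -
  interpret finite_measure N by fact
  have "uniform_measure N A = density N (\<lambda>x. ennreal (indicator A x / measure N A))"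
    unfolding uniform_measure_def using pos
    by (intro arg_cong2[where f=density] refl ext)
       (simp add: emeasure_eq_measure divide_ennreal[of 1, simplified] split: split_indicator)
  then show ?thesis
    using A h by (simp add: integral_real_density set_lebesgue_integral_def)
qed

text \<open>\<open>h / L\<close> is a test function of \<open>tv_dist\<close>. In this normalization
  the factor is \<open>L\<close>; with the supremum over sets it would be
  \<open>2 * L\<close>.\<close>

lemma abs_integral_diff_le_tv_dist:
  assumes N: "prob_space N" "prob_space N'" "sets N = sets N'"
    and h: "h \<in> borel_measurable N" and bound: "\<And>x. x \<in> space N \<Longrightarrow> \<bar>h x\<bar> \<le> L"
  shows "\<bar>(\<integral>x. h x \<partial>N) - (\<integral>x. h x \<partial>N')\<bar> \<le> L * tv_dist N N'"
proof -
  interpret N: prob_space N by fact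
  interpret N': prob_space N' by fact
  have sp: "space N = space N'" using N(3) by (rule sets_eq_imp_space_eq)
  have meas: "g \<in> borel_measurable N'" if "g \<in> borel_measurable N" for g :: "'a \<Rightarrow> real"
    using that measurable_cong_sets[OF N(3) refl] by blast
  have le_1: "\<bar>\<integral>x. g x \<partial>N\<bar> \<le> 1" if "prob_space N" "g \<in> borel_measurable N" "\<forall>x\<in>space N. \<bar>g x\<bar> \<le> 1"
    for g :: "'a \<Rightarrow> real" and N
  proof -
    interpret prob_space N by fact
    have "\<bar>\<integral>x. g x \<partial>N\<bar> \<le> (\<integral>x. \<bar>g x\<bar> \<partial>N)" by (rule integral_abs_bound)
    also have "\<dots> \<le> (\<integral>x. 1 \<partial>N)"
      using that by (intro integral_mono integrable_const_bound[of _ 1]) auto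
    finally show ?thesis by (simp add: prob_space)
  qed
  have le_2: "\<bar>(\<integral>x. g x \<partial>N) - (\<integral>x. g x \<partial>N')\<bar> \<le> 2"
    if "g \<in> borel_measurable N" "\<forall>x\<in>space N. \<bar>g x\<bar> \<le> 1" for g :: "'a \<Rightarrow> real"
    using le_1[OF N(1) that] le_1[OF N(2) meas[OF that(1)]] that(2) sp by (simp add: abs_le_iff)
  \<comment> \<open>A real supremum bounds its members only if the family is bounded; 2 works for
    two probability measures.\<close>
  have bdd: "bdd_above ((\<lambda>g. \<bar>(\<integral>x. g x \<partial>N) - (\<integral>x. g x \<partial>N')\<bar>) `
      {g \<in> borel_measurable N. \<forall>x\<in>space N. \<bar>g x\<bar> \<le> (1 :: real)})"
  by (intro bdd_aboveI2[where M=2] le_2) auto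
  obtain z where "z \<in> space N" using N.not_empty by blast
  from bound[OF this] have "0 \<le> L" by linarith
  show ?thesis
  \<comment> \<open>The scaling by \<open>L\<close> is impossible here, but then \<open>h\<close>
    vanishes on the whole space.\<close>
  proof (cases "L = 0")
    case True
    then have "h x = 0" if "x \<in> space N" for x using bound[OF that] by simp
    then have "(\<integral>x. h x \<partial>N) = (\<integral>x. 0 \<partial>N)" "(\<integral>x. h x \<partial>N') = (\<integral>x. 0 \<partial>N')"
      by (intro Bochner_Integration.integral_cong refl; simp add: sp)+
    with True show ?thesis by simp
  next
    case False
    with \<open>0 \<le> L\<close> have L: "L > 0" by simp
    have "\<bar>(\<integral>x. h x / L \<partial>N) - (\<integral>x. h x / L \<partial>N')\<bar> \<le> tv_dist N N'"
      unfolding tv_dist_def using h bound L by (intro cSUP_upper[OF _ bdd]) auto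
    moreover have "\<bar>(\<integral>x. h x / L \<partial>N) - (\<integral>x. h x / L \<partial>N')\<bar> =
        \<bar>(\<integral>x. h x \<partial>N) - (\<integral>x. h x \<partial>N')\<bar> / L"
      using L by (simp flip: diff_divide_distrib)
    ultimately show ?thesis using L by (simp add: field_simps)
  qed
qed

lemma l1_norm_diff_measurable:
  fixes X :: "(real ^ 'n) set"
  shows "(\<lambda>(x, x'). l1_norm (x - x')) \<in> borel_measurable (state_space X \<Otimes>\<^sub>M state_space X)"
proof -
  have "(\<lambda>p. l1_norm (fst p - snd p)) \<in> borel_measurable (borel :: ((real ^ 'n) \<times> (real ^ 'n)) measure)"
    unfolding l1_norm_def by (intro borel_measurable_continuous_onI continuous_intros)
  moreover have "(\<lambda>x. x) \<in> state_space X \<rightarrow>\<^sub>M borel" by (intro measurable_restrict_space1) simp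
  then have "(\<lambda>p. (fst p, snd p)) \<in> state_space X \<Otimes>\<^sub>M state_space X \<rightarrow>\<^sub>M (borel \<Otimes>\<^sub>M borel)"
    by (intro measurable_Pair measurable_compose[OF measurable_fst] measurable_compose[OF measurable_snd])
  ultimately show ?thesis
    unfolding borel_prod by (auto dest: measurable_compose simp: case_prod_beta)
qed

section \<open>Bins, bin averages and the fixed point equation of the limit Q-function\<close>

locale quantized_mdp = markov_decision_process X T c \<beta> K
  for X :: "(real ^ 'n) set" and T :: "real ^ 'n \<Rightarrow> 'u::finite \<Rightarrow> (real ^ 'n) measure"
    and c :: "real ^ 'n \<Rightarrow> 'u \<Rightarrow> real" and \<beta> K :: real +
  fixes \<alpha>\<^sub>c \<alpha>\<^sub>T :: real and M :: nat and B :: "nat \<Rightarrow> (real ^ 'n) set" and y :: "nat \<Rightarrow> real ^ 'n"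
    and q :: "real ^ 'n \<Rightarrow> real ^ 'n" and \<pi> :: "(real ^ 'n) measure" and Qstar :: "real ^ 'n \<Rightarrow> 'u \<Rightarrow> real"
  assumes lip_nonneg: "0 \<le> \<alpha>\<^sub>c" "0 \<le> \<alpha>\<^sub>T"
    and c_lip: "\<And>x x' u. x \<in> X \<Longrightarrow> x' \<in> X \<Longrightarrow> \<bar>c x u - c x' u\<bar> \<le> \<alpha>\<^sub>c * l1_norm (x - x')"
    and T_lip: "\<And>x x' u. x \<in> X \<Longrightarrow> x' \<in> X \<Longrightarrow> tv_dist (T x u) (T x' u) \<le> \<alpha>\<^sub>T * l1_norm (x - x')"
    and quantizer: "quantization X M B y q"
    and \<pi>: "\<pi> \<in> space (prob_algebra (state_space X))"
    and bins_pos: "\<And>i. i \<in> {1..M} \<Longrightarrow> measure \<pi> (B i) > 0"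
    and limit_Q: "is_limit_Q X T c \<beta> q (y ` {1..M}) \<pi> Qstar"
begin

abbreviation "J x \<equiv> (MIN v. Qstar (q x) v)"
abbreviation "pi_hat i \<equiv> uniform_measure \<pi> (B i)"
abbreviation "Lip \<equiv> \<alpha>\<^sub>c + \<beta> * \<alpha>\<^sub>T * K / (1 - \<beta>)"

lemma B_sets: "i \<in> {1..M} \<Longrightarrow> B i \<in> sets S" and B_disjoint: "disjoint_family_on B {1..M}"
  and B_union: "(\<Union>i\<in>{1..M}. B i) = X" and y_in: "i \<in> {1..M} \<Longrightarrow> y i \<in> B i"
  and q_bin: "i \<in> {1..M} \<Longrightarrow> x \<in> B i \<Longrightarrow> q x = y i"
  using quantizer by (auto simp: quantization_def)

lemma B_subset: "i \<in> {1..M} \<Longrightarrow> B i \<subseteq> X" using B_union by blast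

lemma bin_cases:
  assumes "x \<in> X" obtains i where "i \<in> {1..M}" "x \<in> B i"
  using assms B_union by blast

lemma bin_unique: "i \<in> {1..M} \<Longrightarrow> j \<in> {1..M} \<Longrightarrow> x \<in> B i \<Longrightarrow> x \<in> B j \<Longrightarrow> i = j"
  using B_disjoint unfolding disjoint_family_on_def by blast

lemma indicator_bin:
  "i \<in> {1..M} \<Longrightarrow> x \<in> B i \<Longrightarrow> j \<in> {1..M} \<Longrightarrow> indicator (B j) x = (if j = i then 1 else 0)"
  by (metis bin_unique indicator_simps)

lemma inj_y: "inj_on y {1..M}"
  by (rule inj_onI) (metis bin_unique y_in)

lemma q_y: "i \<in> {1..M} \<Longrightarrow> q (y i) = y i" using q_bin y_in by blast

lemma bin_of_y: "i \<in> {1..M} \<Longrightarrow> bin_of X q (y i) = B i"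
proof (intro set_eqI iffI)
  fix x assume i: "i \<in> {1..M}" and "x \<in> bin_of X q (y i)"
  then have x: "x \<in> X" "q x = y i" by (auto simp: bin_of_def)
  then obtain j where j: "j \<in> {1..M}" "x \<in> B j" by (auto elim: bin_cases)
  with x q_bin have "y j = y i" by simp
  with inj_y i j show "x \<in> B i" by (auto dest: inj_onD)
qed (use q_bin B_subset in \<open>auto simp: bin_of_def\<close>)

text \<open>A function of \<open>q x\<close> is a step function, hence measurable although \<open>q\<close> itself is
  unconstrained outside \<open>X\<close>.\<close>

lemma quantized_step_function:
  fixes h :: "real ^ 'n \<Rightarrow> real"
  assumes "x \<in> X"
  shows "h (q x) = (\<Sum>i=1..M. h (y i) * indicator (B i) x)"
proof -
  obtain j where j: "j \<in> {1..M}" "x \<in> B j" using assms by (rule bin_cases)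
  have "(\<Sum>i=1..M. h (y i) * indicator (B i) x) = (\<Sum>i=1..M. if i = j then h (y j) else 0)"
    by (intro sum.cong refl) (subst indicator_bin[OF j], simp_all)
  then show ?thesis using j q_bin by simp
qed

lemma quantized_measurable:
  fixes h :: "real ^ 'n \<Rightarrow> real"
  shows "(\<lambda>x. h (q x)) \<in> borel_measurable S"
proof -
  have "(\<lambda>x. \<Sum>i=1..M. h (y i) * indicator (B i) x) \<in> borel_measurable S"
    using B_sets by (intro borel_measurable_sum borel_measurable_times) auto
  then show ?thesis
    by (rule measurable_cong[THEN iffD1, rotated]) (simp only: space_S quantized_step_function)
qed

lemma J_measurable: "(\<lambda>x. J x) \<in> borel_measurable S" by (rule quantized_measurable)

text \<open>J is constant on bins, so its integral sees only the bin probabilities, the quantities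
  that \<open>quantized_kernel\<close> averages.\<close>

lemma integral_T_J:
  assumes x: "x \<in> X"
  shows "(\<integral>z. J z \<partial>T x u) = (\<Sum>j=1..M. J (y j) * measure (T x u) (B j))"
proof -
  interpret prob_space "T x u" by (rule T_prob[OF x])
  have B: "B j \<in> sets (T x u)" if "j \<in> {1..M}" for j using B_sets[OF that] sets_T[OF x] by simp
  have "(\<integral>z. J z \<partial>T x u) = (\<integral>z. (\<Sum>j=1..M. J (y j) * indicator (B j) z) \<partial>T x u)"
    \<comment> \<open>\<open>J (y j)\<close> contains \<open>q (y j)\<close>, and \<open>q\<close>
      fixes representatives.\<close>
    using quantized_step_function[where h="\<lambda>z. MIN v. Qstar z v"]
    by (intro Bochner_Integration.integral_cong refl) (simp add: space_T[OF x] q_y)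
  also have "\<dots> = (\<Sum>j=1..M. \<integral>z. J (y j) * indicator (B j) z \<partial>T x u)"
    using B by (intro Bochner_Integration.integral_sum integrable_mult_right) (auto simp: emeasure_eq_measure)
  also have "\<dots> = (\<Sum>j=1..M. J (y j) * measure (T x u) (B j))"
    using B by (intro sum.cong refl) simp
  finally show ?thesis .
qed

lemma sets_\<pi>: "sets \<pi> = sets S" and prob_\<pi>: "prob_space \<pi>"
  using \<pi> by (auto simp: space_prob_algebra)

lemma space_\<pi>: "space \<pi> = X" using sets_eq_imp_space_eq[OF sets_\<pi>] space_S by simp

lemma prob_pi_hat: "i \<in> {1..M} \<Longrightarrow> prob_space (pi_hat i)"
proof (rule prob_space_uniform_measure)
  interpret prob_space \<pi> by (rule prob_\<pi>)
  show "i \<in> {1..M} \<Longrightarrow> emeasure \<pi> (B i) \<noteq> 0" and "emeasure \<pi> (B i) \<noteq> \<infinity>"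
    using bins_pos[of i] by (auto simp: emeasure_eq_measure)
qed

lemma AE_pi_hat: "i \<in> {1..M} \<Longrightarrow> AE x in pi_hat i. x \<in> B i"
  using B_sets sets_\<pi> by (intro AE_uniform_measureI) auto

lemma measurable_pi_hat: "measurable (pi_hat i) N = measurable S N"
  using sets_\<pi> by (intro measurable_cong_sets) auto

lemma integral_pi_hat:
  fixes h :: "real ^ 'n \<Rightarrow> real"
  assumes "i \<in> {1..M}" "h \<in> borel_measurable S"
  shows "1 / measure \<pi> (B i) * (LINT x:B i|\<pi>. h x) = (\<integral>x. h x \<partial>pi_hat i)"
  using assms B_sets bins_pos sets_\<pi> prob_space.finite_measure[OF prob_\<pi>]
  by (intro integral_uniform_measure[symmetric]) (auto simp: measurable_cong_sets[OF sets_\<pi> refl])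

lemma integrable_pi_hat:
  fixes h :: "real ^ 'n \<Rightarrow> real"
  assumes "i \<in> {1..M}" "h \<in> borel_measurable S" "\<And>x. x \<in> X \<Longrightarrow> \<bar>h x\<bar> \<le> L"
  shows "integrable (pi_hat i) h"
proof -
  interpret prob_space "pi_hat i" by (rule prob_pi_hat[OF assms(1)])
  show ?thesis using assms
    by (intro integrable_const_bound[of _ L]) (auto simp: measurable_pi_hat space_\<pi>)
qed

text \<open>Cost and bin probabilities are averaged with the same measure \<open>pi_hat i\<close>.
  Pulling this average out of the finite sum over bins reassembles the integral of J against the
  original kernel.\<close>

lemma Qstar_eq:
  assumes i: "i \<in> {1..M}"
  shows "Qstar (y i) u = (\<integral>x. action_value (\<lambda>x. J x) x u \<partial>pi_hat i)"
proof -
  let ?m = "\<lambda>j x. measure (T x u) (B j)"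
  have m: "?m j \<in> borel_measurable S" if "j \<in> {1..M}" for j
    using B_sets[OF that] by (intro measurable_compose[OF kernel_subprob1 measurable_measure_subprob_algebra])
  have mi: "integrable (pi_hat i) (?m j)" if "j \<in> {1..M}" for j
    using m[OF that] by (intro integrable_pi_hat[OF i, where L=1]) (auto simp: prob_space.prob_le_1[OF T_prob])
  have ci: "integrable (pi_hat i) (\<lambda>x. c x u)"
    using cost_measurable cost_bound by (intro integrable_pi_hat[OF i])
  interpret prob_space "pi_hat i" by (rule prob_pi_hat[OF i])
  have "Qstar (y i) u = quantized_cost X c q \<pi> (y i) u +
      \<beta> * (\<Sum>z\<in>y ` {1..M}. quantized_kernel X T q \<pi> z (y i) u * (MIN v. Qstar z v))"
    using limit_Q i unfolding is_limit_Q_def by blast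
  also have "quantized_cost X c q \<pi> (y i) u = (\<integral>x. c x u \<partial>pi_hat i)"
    unfolding quantized_cost_def bin_of_y[OF i] by (rule integral_pi_hat[OF i cost_measurable])
  also have "(\<Sum>z\<in>y ` {1..M}. quantized_kernel X T q \<pi> z (y i) u * (MIN v. Qstar z v)) =
      (\<Sum>j=1..M. (\<integral>x. ?m j x \<partial>pi_hat i) * J (y j))"
    unfolding sum.reindex[OF inj_y] comp_def
  proof (intro sum.cong refl)
    fix j assume j: "j \<in> {1..M}"
    show "quantized_kernel X T q \<pi> (y j) (y i) u * (MIN v. Qstar (y j) v) =
        (\<integral>x. ?m j x \<partial>pi_hat i) * J (y j)"
      unfolding quantized_kernel_def bin_of_y[OF i] bin_of_y[OF j] q_y[OF j] integral_pi_hat[OF i m[OF j]] ..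
  qed
  also have "(\<integral>x. c x u \<partial>pi_hat i) + \<beta> * (\<Sum>j=1..M. (\<integral>x. ?m j x \<partial>pi_hat i) * J (y j)) =
      (\<integral>x. c x u + \<beta> * (\<Sum>j=1..M. J (y j) * ?m j x) \<partial>pi_hat i)"
  proof -
    have "integrable (pi_hat i) (\<lambda>x. \<Sum>j=1..M. J (y j) * ?m j x)"
      by (intro Bochner_Integration.integrable_sum integrable_mult_right mi)
    moreover have "(\<integral>x. (\<Sum>j=1..M. J (y j) * ?m j x) \<partial>pi_hat i) = (\<Sum>j=1..M. (\<integral>x. ?m j x \<partial>pi_hat i) * J (y j))"
      by (subst Bochner_Integration.integral_sum) (auto intro: mi simp: mult.commute)
    ultimately show ?thesis using ci by simp
  qed
  also have "\<dots> = (\<integral>x. action_value (\<lambda>x. J x) x u \<partial>pi_hat i)"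
    by (intro Bochner_Integration.integral_cong refl) (simp add: action_value_def integral_T_J space_\<pi>)
  finally show ?thesis .
qed

text \<open>The largest absolute entry \<open>m\<close> of the Q-function satisfies
  \<open>m \<le> K + \<beta> * m\<close>, since each entry is an average of one-step values of a
  function bounded by \<open>m\<close>. Finiteness of the table makes \<open>m\<close> a real number
  beforehand, so the inequality can be solved.\<close>

lemma J_bound:
  assumes "x \<in> X"
  shows "\<bar>J x\<bar> \<le> K / (1 - \<beta>)"
proof -
  define m where "m = (MAX (i, u) \<in> {1..M} \<times> UNIV. \<bar>Qstar (y i) u\<bar>)"
  have le_m: "\<bar>Qstar (y i) u\<bar> \<le> m" if "i \<in> {1..M}" for i u
    unfolding m_def using that by (intro Max_ge) auto
  have J_m: "\<bar>J x\<bar> \<le> m" if x: "x \<in> X" for x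
  proof -
    obtain i where i: "i \<in> {1..M}" "x \<in> B i" using x by (rule bin_cases)
    show ?thesis using le_m[OF i(1)] q_bin[OF i] by (intro abs_MIN_le) simp
  qed
  have Q_m: "\<bar>Qstar (y i) u\<bar> \<le> K + \<beta> * m" if i: "i \<in> {1..M}" for i u
  proof -
    interpret prob_space "pi_hat i" by (rule prob_pi_hat[OF i])
    note av = abs_action_value_le[OF J_measurable J_m]
    have int: "integrable (pi_hat i) (\<lambda>x. action_value (\<lambda>x. J x) x u)"
      by (rule integrable_pi_hat[OF i action_value_measurable[OF J_measurable] av])
    have "\<bar>Qstar (y i) u\<bar> \<le> (\<integral>x. \<bar>action_value (\<lambda>x. J x) x u\<bar> \<partial>pi_hat i)"
      unfolding Qstar_eq[OF i] by (rule integral_abs_bound)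
    also have "\<dots> \<le> (\<integral>x. K + \<beta> * m \<partial>pi_hat i)"
      using int by (intro integral_mono) (auto simp: space_\<pi> av)
    finally show ?thesis using prob_space by simp
  qed
  obtain i where i: "i \<in> {1..M}" "x \<in> B i" using assms by (rule bin_cases)
  \<comment> \<open>The bin of \<open>x\<close> makes the index set nonempty, so the maximum is
    attained.\<close>
  have "m \<in> (\<lambda>(i, u). \<bar>Qstar (y i) u\<bar>) ` ({1..M} \<times> UNIV)"
    unfolding m_def using i by (intro Max_in) auto
  with Q_m have "m \<le> K + \<beta> * m" by auto
  then have "m \<le> K / (1 - \<beta>)" using discount by (simp add: field_simps)
  with J_m[OF assms] show ?thesis by simp
qed

section \<open>Lipschitz one-step values and the mean distance to a bin\<close>

lemma K_nonneg: "x \<in> X \<Longrightarrow> 0 \<le> K"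
  using cost_bound[of x undefined] by linarith

lemma l1_norm_nonneg: "0 \<le> l1_norm z"
  unfolding l1_norm_def by (intro sum_nonneg) simp

text \<open>J is a step function, so regularity must come from the kernel. Total variation pays for
  a change of state with the sup norm of J, whose bound \<open>K / (1 - \<beta>)\<close> yields the
  second summand of \<open>Lip\<close>.\<close>

lemma action_value_lipschitz:
  assumes x: "x \<in> X" and x': "x' \<in> X"
  shows "\<bar>action_value (\<lambda>x. J x) x u - action_value (\<lambda>x. J x) x' u\<bar> \<le> Lip * l1_norm (x - x')"
proof -
  let ?L = "K / (1 - \<beta>)"
  have "\<bar>(\<integral>z. J z \<partial>T x u) - (\<integral>z. J z \<partial>T x' u)\<bar> \<le> ?L * tv_dist (T x u) (T x' u)"
    using J_measurable J_bound
    by (intro abs_integral_diff_le_tv_dist)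
       (auto simp: T_prob sets_T space_T x x' measurable_cong_sets[OF sets_T[OF x] refl])
  also have "\<dots> \<le> ?L * (\<alpha>\<^sub>T * l1_norm (x - x'))"
    using K_nonneg[OF x] discount by (intro mult_left_mono T_lip x x') simp
  finally have "\<beta> * \<bar>(\<integral>z. J z \<partial>T x u) - (\<integral>z. J z \<partial>T x' u)\<bar> \<le> \<beta> * (?L * (\<alpha>\<^sub>T * l1_norm (x - x')))"
    using discount by (intro mult_left_mono) auto
  moreover have "\<bar>action_value (\<lambda>x. J x) x u - action_value (\<lambda>x. J x) x' u\<bar> \<le>
      \<bar>c x u - c x' u\<bar> + \<beta> * \<bar>(\<integral>z. J z \<partial>T x u) - (\<integral>z. J z \<partial>T x' u)\<bar>"
  proof -
    have "action_value (\<lambda>x. J x) x u - action_value (\<lambda>x. J x) x' u =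
        (c x u - c x' u) + \<beta> * ((\<integral>z. J z \<partial>T x u) - (\<integral>z. J z \<partial>T x' u))"
      by (simp add: action_value_def algebra_simps)
    then show ?thesis 
      using discount abs_triangle_ineq[of "c x u - c x' u" "\<beta> * ((\<integral>z. J z \<partial>T x u) - (\<integral>z. J z \<partial>T x' u))"]
      by (simp add: abs_mult)
  qed
  ultimately show ?thesis using c_lip[OF x x', of u] by (simp add: algebra_simps)
qed

text \<open>The mean distance D(x) of the overview. On \<open>X\<close> exactly one indicator is
  nonzero; the form as a sum over bins matches the double integral of the theorem.\<close>

definition bin_spread :: "real ^ 'n \<Rightarrow> ennreal" where
  "bin_spread x = (\<Sum>i=1..M. (\<integral>\<^sup>+x'\<in>B i. ennreal (l1_norm (x - x')) \<partial>pi_hat i) * indicator (B i) x)"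

lemma bin_spread_eq:
  assumes i: "i \<in> {1..M}" and x: "x \<in> B i"
  shows "bin_spread x = (\<integral>\<^sup>+x'\<in>B i. ennreal (l1_norm (x - x')) \<partial>pi_hat i)"
proof -
  have "bin_spread x = (\<Sum>j=1..M. if j = i then \<integral>\<^sup>+x'\<in>B i. ennreal (l1_norm (x - x')) \<partial>pi_hat i else 0)"
    unfolding bin_spread_def by (intro sum.cong refl) (subst indicator_bin[OF i x], simp_all)
  then show ?thesis using i by simp
qed

lemma l1_norm_measurable_snd: "x \<in> X \<Longrightarrow> (\<lambda>x'. l1_norm (x - x')) \<in> borel_measurable S"
  using measurable_compose[OF measurable_Pair1' l1_norm_diff_measurable, of x X] by (simp add: space_S)

lemma quantization_gap:
  assumes x: "x \<in> X"
  shows "ennreal \<bar>action_value (\<lambda>x. J x) x u - Qstar (q x) u\<bar> \<le> ennreal Lip * bin_spread x"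
proof -
  obtain i where i: "i \<in> {1..M}" "x \<in> B i" using x by (rule bin_cases)
  interpret prob_space "pi_hat i" by (rule prob_pi_hat[OF i(1)])
  let ?a = "\<lambda>x. action_value (\<lambda>x. J x) x u"
  have int: "integrable (pi_hat i) ?a"
    by (rule integrable_pi_hat[OF i(1) action_value_measurable[OF J_measurable]
          abs_action_value_le[OF J_measurable J_bound]])
  have Lip: "0 \<le> Lip" using K_nonneg[OF x] lip_nonneg discount by simp
  \<comment> \<open>As \<open>pi_hat i\<close> has mass 1, the constant \<open>?a x\<close> may be
    moved under its integral.\<close>
  have "?a x - Qstar (q x) u = (\<integral>x'. ?a x - ?a x' \<partial>pi_hat i)"
    unfolding q_bin[OF i] Qstar_eq[OF i(1)] using int prob_space by simp
  then have "\<bar>?a x - Qstar (q x) u\<bar> \<le> (\<integral>x'. \<bar>?a x - ?a x'\<bar> \<partial>pi_hat i)"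
    by (simp only: integral_abs_bound)
  then have "ennreal \<bar>?a x - Qstar (q x) u\<bar> \<le> ennreal (\<integral>x'. \<bar>?a x - ?a x'\<bar> \<partial>pi_hat i)"
    by (rule ennreal_leI)
  also have "\<dots> \<le> (\<integral>\<^sup>+x'. ennreal \<bar>?a x - ?a x'\<bar> \<partial>pi_hat i)"
    using int by (intro ennreal_integral_le_nn_integral) simp
  \<comment> \<open>\<open>pi_hat i\<close> is a measure on all of \<open>X\<close> concentrated on
    \<open>B i\<close>, so the indicator may be inserted almost everywhere.\<close>
  also have "\<dots> \<le> (\<integral>\<^sup>+x'. ennreal Lip * (ennreal (l1_norm (x - x')) * indicator (B i) x') \<partial>pi_hat i)"
  proof (rule nn_integral_mono_AE)
    show "AE x' in pi_hat i. ennreal \<bar>?a x - ?a x'\<bar> \<le>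
        ennreal Lip * (ennreal (l1_norm (x - x')) * indicator (B i) x')"
      using AE_pi_hat[OF i(1)]
    proof eventually_elim
      fix x' assume x': "x' \<in> B i"
      then have "\<bar>?a x - ?a x'\<bar> \<le> Lip * l1_norm (x - x')"
        using B_subset[OF i(1)] x by (intro action_value_lipschitz) auto
      then have "ennreal \<bar>?a x - ?a x'\<bar> \<le> ennreal (Lip * l1_norm (x - x'))" by (rule ennreal_leI)
      also have "\<dots> = ennreal Lip * ennreal (l1_norm (x - x'))"
        using Lip l1_norm_nonneg by (rule ennreal_mult)
      finally show "ennreal \<bar>?a x - ?a x'\<bar> \<le> ennreal Lip * (ennreal (l1_norm (x - x')) * indicator (B i) x')"
        using x' by simp
    qed
  qed
  also have "\<dots> = ennreal Lip * bin_spread x"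
    unfolding bin_spread_eq[OF i] using l1_norm_measurable_snd[OF x] B_sets[OF i(1)]
    by (intro nn_integral_cmult) (simp add: measurable_pi_hat)
  finally show ?thesis .
qed

section \<open>Integrating the mean distance against an occupation measure\<close>

lemma bin_measurable_pair:
  assumes "i \<in> {1..M}"
  shows "(\<lambda>(x, x'). ennreal (l1_norm (x - x')) * indicator (B i) x' * indicator (B i) x)
    \<in> borel_measurable (S \<Otimes>\<^sub>M S)"
proof -
  note B_sets[OF assms, measurable]
  have [measurable]: "(\<lambda>p. ennreal (l1_norm (fst p - snd p))) \<in> borel_measurable (S \<Otimes>\<^sub>M S)"
    using l1_norm_diff_measurable[of X] by (simp add: case_prod_beta)
  show ?thesis unfolding case_prod_beta by measurable
qed

text \<open>Joint measurability gives that of the parameter integral; the indicator of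
  \<open>x\<close> is kept inside for this and pulled out afterwards.\<close>

lemma bin_spread_measurable: "bin_spread \<in> borel_measurable S"
  unfolding bin_spread_def[abs_def]
proof (intro borel_measurable_sum)
  fix i assume i: "i \<in> {1..M}"
  interpret prob_space "pi_hat i" by (rule prob_pi_hat[OF i])
  have "(\<lambda>x. \<integral>\<^sup>+x'. ennreal (l1_norm (x - x')) * indicator (B i) x' * indicator (B i) x \<partial>pi_hat i)
      \<in> borel_measurable S"
    using bin_measurable_pair[OF i] by (intro borel_measurable_nn_integral)
      (simp add: measurable_cong_sets[OF sets_pair_measure_cong[OF refl, of "pi_hat i" S]] sets_\<pi>)
  also have "?this \<longleftrightarrow> (\<lambda>x. (\<integral>\<^sup>+x'\<in>B i. ennreal (l1_norm (x - x')) \<partial>pi_hat i) * indicator (B i) x)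
      \<in> borel_measurable S"
  proof (rule measurable_cong)
    fix x assume "x \<in> space S"
    then have x: "x \<in> X" by (simp add: space_S)
    show "(\<integral>\<^sup>+x'. ennreal (l1_norm (x - x')) * indicator (B i) x' * indicator (B i) x \<partial>pi_hat i) =
        (\<integral>\<^sup>+x'\<in>B i. ennreal (l1_norm (x - x')) \<partial>pi_hat i) * indicator (B i) x"
      using l1_norm_measurable_snd[OF x] B_sets[OF i]
      by (intro nn_integral_multc) (simp add: measurable_pi_hat)
  qed
  finally show "(\<lambda>x. (\<integral>\<^sup>+x'\<in>B i. ennreal (l1_norm (x - x')) \<partial>pi_hat i) * indicator (B i) x)
      \<in> borel_measurable S" .
qed

text \<open>Tonelli: the theorem integrates the occupied state first, whereas the one-step gap
  averages over the bin first.\<close>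

lemma nn_integral_bin_spread:
  assumes "prob_space \<mu>" and sets_\<mu>: "sets \<mu> = sets S"
  shows "(\<Sum>i=1..M. \<integral>\<^sup>+x'\<in>B i. (\<integral>\<^sup>+x\<in>B i. ennreal (l1_norm (x - x')) \<partial>\<mu>) \<partial>pi_hat i) =
    (\<integral>\<^sup>+x. bin_spread x \<partial>\<mu>)"
proof -
  have meas_\<mu>: "measurable \<mu> N = measurable S N" for N :: "ennreal measure"
    using sets_\<mu> by (rule measurable_cong_sets) simp
  have sp: "space \<mu> = X" using sets_eq_imp_space_eq[OF sets_\<mu>] space_S by simp
  have "(\<integral>\<^sup>+x'\<in>B i. (\<integral>\<^sup>+x\<in>B i. ennreal (l1_norm (x - x')) \<partial>\<mu>) \<partial>pi_hat i) =
      (\<integral>\<^sup>+x. (\<integral>\<^sup>+x'\<in>B i. ennreal (l1_norm (x - x')) \<partial>pi_hat i) * indicator (B i) x \<partial>\<mu>)"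
    and "(\<lambda>x. (\<integral>\<^sup>+x'\<in>B i. ennreal (l1_norm (x - x')) \<partial>pi_hat i) * indicator (B i) x) \<in> borel_measurable \<mu>"
    if i: "i \<in> {1..M}" for i
  proof -
    let ?h = "\<lambda>x x'. ennreal (l1_norm (x - x')) * indicator (B i) x' * indicator (B i) x"
    interpret pi_hat: prob_space "pi_hat i" by (rule prob_pi_hat[OF i])
    interpret \<mu>: prob_space \<mu> by fact
    interpret pair_sigma_finite \<mu> "pi_hat i" ..
    have pair: "case_prod ?h \<in> borel_measurable (\<mu> \<Otimes>\<^sub>M pi_hat i)"
      using bin_measurable_pair[OF i] sets_\<mu> sets_\<pi>
      by (subst measurable_cong_sets[OF sets_pair_measure_cong[of \<mu> S "pi_hat i" S] refl]) simp_all
    have snd_int: "(\<integral>\<^sup>+x'. ?h x x' \<partial>pi_hat i) =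
        (\<integral>\<^sup>+x'\<in>B i. ennreal (l1_norm (x - x')) \<partial>pi_hat i) * indicator (B i) x" if "x \<in> X" for x
      using l1_norm_measurable_snd[OF that] B_sets[OF i]
      by (intro nn_integral_multc) (simp add: measurable_pi_hat)
    have "(\<integral>\<^sup>+x'\<in>B i. (\<integral>\<^sup>+x\<in>B i. ennreal (l1_norm (x - x')) \<partial>\<mu>) \<partial>pi_hat i) =
        (\<integral>\<^sup>+x'. (\<integral>\<^sup>+x. ?h x x' \<partial>\<mu>) \<partial>pi_hat i)"
      by (intro nn_integral_cong) (simp split: split_indicator)
    also have "\<dots> = (\<integral>\<^sup>+x. (\<integral>\<^sup>+x'. ?h x x' \<partial>pi_hat i) \<partial>\<mu>)" by (rule Fubini'[OF pair])
    also have "\<dots> = (\<integral>\<^sup>+x. (\<integral>\<^sup>+x'\<in>B i. ennreal (l1_norm (x - x')) \<partial>pi_hat i) * indicator (B i) x \<partial>\<mu>)"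
      by (intro nn_integral_cong snd_int) (simp add: sp)
    finally show "(\<integral>\<^sup>+x'\<in>B i. (\<integral>\<^sup>+x\<in>B i. ennreal (l1_norm (x - x')) \<partial>\<mu>) \<partial>pi_hat i) =
      (\<integral>\<^sup>+x. (\<integral>\<^sup>+x'\<in>B i. ennreal (l1_norm (x - x')) \<partial>pi_hat i) * indicator (B i) x \<partial>\<mu>)" .
    have "(\<lambda>x. \<integral>\<^sup>+x'. ?h x x' \<partial>pi_hat i) \<in> borel_measurable \<mu>"
      using pair by (rule pi_hat.borel_measurable_nn_integral)
    then show "(\<lambda>x. (\<integral>\<^sup>+x'\<in>B i. ennreal (l1_norm (x - x')) \<partial>pi_hat i) * indicator (B i) x) \<in> borel_measurable \<mu>"
      by (rule measurable_cong[THEN iffD1, rotated]) (simp add: snd_int sp)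
  qed
  then show ?thesis
    unfolding bin_spread_def by (subst nn_integral_sum) auto
qed

text \<open>This leaves each direction of the theorem with a single pointwise inequality between
  reals, as the Lipschitz estimate and the occupation measure are already absorbed.\<close>

lemma stationary_gap:
  assumes f: "f \<in> S \<rightarrow>\<^sub>M control_space" and x0: "x0 \<in> X"
    and le: "\<And>x. x \<in> X \<Longrightarrow>
      s * (action_value (\<lambda>x. J x) x (f x) - J x) \<le> \<bar>action_value (\<lambda>x. J x) x (f x) - Qstar (q x) (f x)\<bar>"
  shows "ennreal (s * (discounted_cost X T c \<beta> (deterministic (stationary f)) x0 - J x0)) \<le>
    ennreal Lip * (SUP f \<in> S \<rightarrow>\<^sub>M control_space. ennreal (1 / (1 - \<beta>)) *
         (\<Sum>i = 1..M. \<integral>\<^sup>+ x' \<in> B i. (\<integral>\<^sup>+ x \<in> B i. ennreal (l1_norm (x - x'))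
            \<partial>occupation_measure X T \<beta> (deterministic (stationary f)) x0) \<partial>pi_hat i))"
    (is "_ \<le> _ * (SUP f \<in> _. ?bound f)")
proof -
  let ?g = "deterministic (stationary f) :: nat \<Rightarrow> (real ^ 'n, 'u) information \<Rightarrow> 'u measure"
  let ?P = "law (return S x0) ?g"
  let ?D = "\<lambda>t. \<integral>\<^sup>+\<omega>. bin_spread (fst (\<omega> t)) \<partial>?P"
  have g: "?g \<in> randomized_policies X"
    by (intro deterministic_randomized stationary_admissible f)
  note occ = nn_integral_occupation_measure[OF x0 g bin_spread_measurable]
  have "ennreal (s * (discounted_cost X T c \<beta> ?g x0 - J x0)) \<le>
      (\<Sum>t. ennreal (\<beta> ^ t) * (\<integral>\<^sup>+\<omega>. ennreal Lip * bin_spread (fst (\<omega> t)) \<partial>?P))"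
  proof (rule policy_gap[OF f x0 J_measurable J_bound])
    show "ennreal (s * (action_value (\<lambda>x. J x) x (f x) - J x)) \<le> ennreal Lip * bin_spread x"
      if "x \<in> X" for x
      using ennreal_leI[OF le[OF that]] quantization_gap[OF that] by (rule order_trans)
  qed
  also have "\<dots> = (\<Sum>t. ennreal Lip * (ennreal (\<beta> ^ t) * ?D t))"
    using measurable_compose[OF law_state[OF point_mass[OF x0] g] bin_spread_measurable]
    by (simp add: nn_integral_cmult mult.left_commute)
  \<comment> \<open>The inserted factor 1 supplies the normalization \<open>1 - \<beta>\<close> of
    the occupation measure and cancels it again.\<close>
  also have "\<dots> = ennreal Lip * (ennreal (1 / (1 - \<beta>)) * (ennreal (1 - \<beta>) * (\<Sum>t. ennreal (\<beta> ^ t) * ?D t)))"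
  proof -
    have "ennreal (1 / (1 - \<beta>)) * (ennreal (1 - \<beta>) * z) = z" for z
      using discount by (simp add: mult.assoc[symmetric] flip: ennreal_mult')
    then show ?thesis by simp
  qed
  also have "\<dots> = ennreal Lip * ?bound f"
    using nn_integral_bin_spread[OF occ(3,2)] occ(1) by simp
  also have "\<dots> \<le> ennreal Lip * (SUP f \<in> S \<rightarrow>\<^sub>M control_space. ?bound f)"
    using f by (intro mult_left_mono SUP_upper) auto
  finally show ?thesis .
qed

lemma abs_optimal_cost_minus_J_le:
  assumes x0: "x0 \<in> X"
  shows "ennreal \<bar>optimal_cost X T c \<beta> x0 - J x0\<bar> \<le>
    ennreal Lip * (SUP f \<in> S \<rightarrow>\<^sub>M control_space. ennreal (1 / (1 - \<beta>)) *
         (\<Sum>i = 1..M. \<integral>\<^sup>+ x' \<in> B i. (\<integral>\<^sup>+ x \<in> B i. ennreal (l1_norm (x - x'))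
            \<partial>occupation_measure X T \<beta> (deterministic (stationary f)) x0) \<partial>pi_hat i))"
    (is "_ \<le> ?bound")
proof -
  obtain f where f: "f \<in> S \<rightarrow>\<^sub>M control_space"
    and opt: "optimal_cost X T c \<beta> x0 = discounted_cost X T c \<beta> (deterministic (stationary f)) x0"
    and opt_le: "\<And>f'. f' \<in> S \<rightarrow>\<^sub>M control_space \<Longrightarrow>
       optimal_cost X T c \<beta> x0 \<le> discounted_cost X T c \<beta> (deterministic (stationary f')) x0"
    using x0 by (rule optimal_stationary_policy) blast
  obtain f' where f': "f' \<in> S \<rightarrow>\<^sub>M control_space" and greedy: "\<And>x. Qstar (q x) (f' x) = J x"
    by (rule measurable_greedy_selector[of "\<lambda>x. Qstar (q x)" S, OF quantized_measurable]) blast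
  have "ennreal (- 1 * (optimal_cost X T c \<beta> x0 - J x0)) \<le> ?bound"
    unfolding opt
  proof (rule stationary_gap[OF f x0])
    \<comment> \<open>The optimal \<open>f\<close> need not be greedy for \<open>Qstar\<close>; J
      being a minimum gives J - A \<le> Q* - A at any control.\<close>
    fix x
    have le: "- 1 * (a - j) \<le> \<bar>a - b\<bar>" if "j \<le> b" for a b j :: real
      using that by (auto simp: abs_if)
    show "- 1 * (action_value (\<lambda>x. J x) x (f x) - J x) \<le>
        \<bar>action_value (\<lambda>x. J x) x (f x) - Qstar (q x) (f x)\<bar>" by (intro le Min_le) auto
  qed
  moreover have "ennreal (optimal_cost X T c \<beta> x0 - J x0) \<le> ?bound"
  proof -
    have "ennreal (optimal_cost X T c \<beta> x0 - J x0) \<le>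
        ennreal (1 * (discounted_cost X T c \<beta> (deterministic (stationary f')) x0 - J x0))"
      using opt_le[OF f'] by (intro ennreal_leI) simp
    also have "\<dots> \<le> ?bound" by (rule stationary_gap[OF f' x0]) (simp add: greedy)
    finally show ?thesis .
  qed
  \<comment> \<open>Truncation empties the half with the wrong sign, and the other half is the
    absolute value.\<close>
  ultimately show ?thesis by (simp add: abs_if)
qed

end

theorem theorem3p2:
  fixes X :: "(real ^ 'n) set"
    and T :: "real ^ 'n \<Rightarrow> 'u::finite \<Rightarrow> (real ^ 'n) measure"
    and c :: "real ^ 'n \<Rightarrow> 'u \<Rightarrow> real"
    and \<beta> \<alpha>\<^sub>c \<alpha>\<^sub>T :: real
    and M :: nat and B :: "nat \<Rightarrow> (real ^ 'n) set" and y :: "nat \<Rightarrow> real ^ 'n"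
    and q :: "real ^ 'n \<Rightarrow> real ^ 'n"
    and \<gamma> :: "nat \<Rightarrow> (real ^ 'n, 'u) information \<Rightarrow> 'u measure"
    and \<nu> \<pi> :: "(real ^ 'n) measure"
    and a Q :: "(nat \<Rightarrow> (real ^ 'n) \<times> 'u) \<Rightarrow> nat \<Rightarrow> real ^ 'n \<Rightarrow> 'u \<Rightarrow> real"
    and Qstar :: "real ^ 'n \<Rightarrow> 'u \<Rightarrow> real"
    and x\<^sub>0 :: "real ^ 'n"
  assumes X_borel: "X \<in> sets borel"
    and T_kernel: "(\<lambda>(x, u). T x u) \<in> step_space X \<rightarrow>\<^sub>M prob_algebra (state_space X)"
    and c_cont: "\<forall>u. continuous_on X (\<lambda>x. c x u)"
    and c_bounded: "bounded ((\<lambda>(x, u). c x u) ` (X \<times> UNIV))"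
    and \<beta>: "0 < \<beta>" "\<beta> < 1"
    and pos: "\<alpha>\<^sub>c > 0" "\<alpha>\<^sub>T > 0"
    and c_lip: "\<forall>x\<in>X. \<forall>x'\<in>X. \<forall>u. \<bar>c x u - c x' u\<bar> \<le> \<alpha>\<^sub>c * l1_norm (x - x')"
    and T_lip: "\<forall>x\<in>X. \<forall>x'\<in>X. \<forall>u. tv_dist (T x u) (T x' u) \<le> \<alpha>\<^sub>T * l1_norm (x - x')"
    and quantizer: "quantization X M B y q"
    and exploration: "\<gamma> \<in> randomized_policies X" "\<nu> \<in> space (prob_algebra (state_space X))"
    and step_sizes: "\<forall>\<omega>\<in>space (trajectory_law X T \<nu> \<gamma>).
      q_learning_step_sizes q (y ` {1..M}) \<omega> (a \<omega>)"
    and q_learning: "\<forall>\<omega>\<in>space (trajectory_law X T \<nu> \<gamma>).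
      q_learning_iterates c \<beta> q (y ` {1..M}) \<omega> (a \<omega>) (Q \<omega>)"
    and ergodic: "uniquely_ergodic X T \<gamma> \<pi>"
    and visits: "AE \<omega> in trajectory_law X T \<nu> \<gamma>.
      \<forall>z\<in>y ` {1..M}. \<forall>u. infinite {t. q (fst (\<omega> t)) = z \<and> snd (\<omega> t) = u}"
    and bins_pos: "\<forall>i\<in>{1..M}. measure \<pi> (B i) > 0"
    and Qstar: "is_limit_Q X T c \<beta> q (y ` {1..M}) \<pi> Qstar"
    and x\<^sub>0: "x\<^sub>0 \<in> X"
  shows "ennreal \<bar>optimal_cost X T c \<beta> x\<^sub>0 - (MIN v. Qstar (q x\<^sub>0) v)\<bar>
    \<le> ennreal (\<alpha>\<^sub>c + \<beta> * \<alpha>\<^sub>T * sup_norm_on X c / (1 - \<beta>)) *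
      (SUP f \<in> state_space X \<rightarrow>\<^sub>M control_space.
         ennreal (1 / (1 - \<beta>)) *
         (\<Sum>i = 1..M. \<integral>\<^sup>+ x' \<in> B i. (\<integral>\<^sup>+ x \<in> B i. ennreal (l1_norm (x - x'))
            \<partial>occupation_measure X T \<beta> (deterministic (stationary f)) x\<^sub>0)
            \<partial>uniform_measure \<pi> (B i)))"
proof -
  \<comment> \<open>The real supremum \<open>sup_norm_on\<close> dominates the cost only if the
    family is bounded above.\<close>
  have "bounded ((\<lambda>(x, u). \<bar>c x u\<bar>) ` (X \<times> UNIV))"
    using c_bounded by (auto simp: bounded_iff)
  then have bdd: "bdd_above ((\<lambda>(x, u). \<bar>c x u\<bar>) ` (X \<times> UNIV))" by (rule bounded_imp_bdd_above)
  interpret quantized_mdp X T c \<beta> "sup_norm_on X c" \<alpha>\<^sub>c \<alpha>\<^sub>T M B y q \<pi> Qstar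
  proof
    show "(\<lambda>x. c x u) \<in> borel_measurable (state_space X)" for u
      using c_cont by (intro borel_measurable_continuous_on_restrict) simp
    show "\<bar>c x u\<bar> \<le> sup_norm_on X c" if "x \<in> X" for x u
      unfolding sup_norm_on_def using that cSUP_upper[OF _ bdd, of "(x, u)"] by simp
    show "\<pi> \<in> space (prob_algebra (state_space X))"
      using ergodic by (simp add: uniquely_ergodic_def invariant_state_law_def)
  qed (use assms in auto)
  show ?thesis by (rule abs_optimal_cost_minus_J_le[OF x\<^sub>0])
qed

end
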